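(* Let $X\in\mathrm{M}(n,q)$, let $c_X(t)=\prod_h h^{\nu(h)}$ be its characteristic polynomial factored over monic irreducibles $h$, and let $v\in V=\mathbb{F}_q^{1\times n}$ be non-zero. Run the procedure IsfWitness$(v,X,c_X)$ described below. Then: (1) the procedure terminates by returning at one of the two return statements inside the while loop, and the loop condition is tested at most $\lfloor\log_2 n\rfloor+2$ times; (2) it returns $(\textsc{True},u,a)$ if and only if $v$ is an $a'$-witness for $X$ for some non-constant monic divisor $a'$ of $c_X(t)$; in that case $u\neq0$, $a=\mathrm{ord}_X(u)$ is non-constant, $\gcd(a,c_X/a)=1$, and $u\,\mathbb{F}_q[X]=\bigoplus_{h\mid a}V(h)\subseteq v\,\mathbb{F}_q[X]$, so that $v$ is an $a$-witness for $X$; (3) it returns False if and only if $o_h(\mathrm{ord}_X(v))<\nu(h)$ for every monic irreducible $h$ dividing $c_X$ such that $X$ is $f$-cyclic relative to $h$; in particular it returns False whenever $X$ is uncyclic.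
   Context: $\mathrm{M}(n,q)$ is the algebra of $n\times n$ matrices over $\mathbb{F}_q$; $V=\mathbb{F}_q^{1\times n}$ is an $\mathbb{F}_q[t]$-module with $t$ acting as $X$. For monic irreducible $h$, $V(h)=\ker h(X)^n$ is the $h$-primary component; $X$ is $f$-cyclic relative to $h$ if $V(h)$ is a cyclic $\mathbb{F}_q[X]$-module, and $X$ is uncyclic if it is $f$-cyclic relative to no irreducible divisor of $c_X$. For $w\in V$, $\mathrm{ord}_X(w)$ is the monic polynomial $a$ of least degree with $w\,a(X)=0$. For a non-zero polynomial $a$ and monic irreducible $h$, $o_h(a)$ is the largest $k$ with $h^k\mid a$. For a non-constant monic divisor $a$ of $c_X$, a vector $w$ is an $a$-witness for $X$ if $V(h)\subseteq w\,\mathbb{F}_q[X]$ for every monic irreducible divisor $h$ of $a$. All gcd's are monic. Procedure IsfWitness$(v,X,c_X)$: set $u:=v$, $g:=1$, $a:=\mathrm{ord}_X(u)$, $d:=\gcd(a,c_X/a)$, $i:=1$. While $i\leq\lfloor\log_2 n\rfloor+2$: if $d=1$ return $(\textsc{True},u,a)$; if $d=a$ return False; otherwise set $g:=g\cdot d$, $u:=v\,g(X)$, $a:=a/d$, $e:=\gcd(a,d)$, $d:=e\cdot\gcd(a/e,e)$, $i:=i+1$. *)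

theory Defs
  imports "Jordan_Normal_Form.Char_Poly" "HOL-Computational_Algebra.Computational_Algebra"
begin

(* Row vector (in F^{1 x n}) times matrix: (v X)_j = sum_i v_i X_ij *)
definition vmul :: "'a :: semiring_0 vec \<Rightarrow> 'a mat \<Rightarrow> 'a vec" where
  "vmul v X = transpose_mat X *\<^sub>v v"

definition poly_mat :: "nat \<Rightarrow> 'a :: comm_ring_1 poly \<Rightarrow> 'a mat \<Rightarrow> 'a mat" where
  "poly_mat n p X = foldr (\<lambda>c B. c \<cdot>\<^sub>m 1\<^sub>m n + X * B) (coeffs p) (0\<^sub>m n n)"

definition vact :: "nat \<Rightarrow> 'a :: comm_ring_1 vec \<Rightarrow> 'a poly \<Rightarrow> 'a mat \<Rightarrow> 'a vec" where
  "vact n w p X = vmul w (poly_mat n p X)"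

definition cyc :: "nat \<Rightarrow> 'a mat \<Rightarrow> 'a :: comm_ring_1 vec \<Rightarrow> 'a vec set" where
  "cyc n X w = {vact n w p X | p. True}"

definition prim :: "nat \<Rightarrow> 'a mat \<Rightarrow> 'a :: comm_ring_1 poly \<Rightarrow> 'a vec set" where
  "prim n X h = {w \<in> carrier_vec n. vact n w (h ^ n) X = 0\<^sub>v n}"

definition monic_irred :: "'a :: field poly \<Rightarrow> bool" where
  "monic_irred h \<longleftrightarrow> monic h \<and> irreducible h"

definition fcyclic :: "nat \<Rightarrow> 'a :: field mat \<Rightarrow> 'a poly \<Rightarrow> bool" where
  "fcyclic n X h \<longleftrightarrow> (\<exists>w \<in> prim n X h. prim n X h = cyc n X w)"

definition uncyclic :: "nat \<Rightarrow> 'a :: field mat \<Rightarrow> bool" where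
  "uncyclic n X \<longleftrightarrow> (\<forall>h. monic_irred h \<and> h dvd char_poly X \<longrightarrow> \<not> fcyclic n X h)"

definition ordX :: "nat \<Rightarrow> 'a :: field mat \<Rightarrow> 'a vec \<Rightarrow> 'a poly" where
  "ordX n X w = (SOME a. monic a \<and> vact n w a X = 0\<^sub>v n \<and>
       (\<forall>b. monic b \<and> vact n w b X = 0\<^sub>v n \<longrightarrow> degree a \<le> degree b))"

definition witness :: "nat \<Rightarrow> 'a :: field mat \<Rightarrow> 'a poly \<Rightarrow> 'a vec \<Rightarrow> bool" where
  "witness n X a w \<longleftrightarrow> (\<forall>h. monic_irred h \<and> h dvd a \<longrightarrow> prim n X h \<subseteq> cyc n X w)"

datatype ('v, 'p) wres = RetTrue 'v 'p | RetFalse | NoReturn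

(* The while loop of IsfWitness.  Arguments: n, X, v, bound, i, g, u, a, d.
   Result: the outcome together with the number of times the loop condition was tested. *)
function isf_loop :: "nat \<Rightarrow> 'a :: {field_gcd} mat \<Rightarrow> 'a vec \<Rightarrow> nat \<Rightarrow> nat \<Rightarrow> 'a poly
     \<Rightarrow> 'a vec \<Rightarrow> 'a poly \<Rightarrow> 'a poly \<Rightarrow> ('a vec, 'a poly) wres \<times> nat" where
  "isf_loop n X v bound i g u a d =
    (if i \<le> bound then
       (if d = 1 then (RetTrue u a, 1)
        else if d = a then (RetFalse, 1)
        else
          (let g' = g * d;
               u' = vact n v g' X;
               a' = a div d;
               e = gcd a' d;
               d' = e * gcd (a' div e) e;
               r = isf_loop n X v bound (i + 1) g' u' a' d'
           in (fst r, snd r + 1)))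
     else (NoReturn, 1))"
  by pat_completeness auto
termination by (relation "measure (\<lambda>(n, X, v, bound, i, _). bound + 1 - i)") auto

definition isf_bound :: "nat \<Rightarrow> nat" where
  "isf_bound n = nat \<lfloor>log 2 (real n)\<rfloor> + 2"

definition IsfWitness :: "nat \<Rightarrow> 'a :: {field_gcd} mat \<Rightarrow> 'a vec \<Rightarrow> 'a poly \<Rightarrow> ('a vec, 'a poly) wres \<times> nat" where
  "IsfWitness n X v cX =
    (let u = v; g = 1; a = ordX n X u; d = gcd a (cX div a)
     in isf_loop n X v (isf_bound n) 1 g u a d)"

definition prim_sum :: "nat \<Rightarrow> 'a :: field mat \<Rightarrow> 'a poly \<Rightarrow> 'a vec set" where
  "prim_sum n X a = {finsum_vec TYPE('a) n f {h. monic_irred h \<and> h dvd a} | f.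
       \<forall>h. monic_irred h \<and> h dvd a \<longrightarrow> f h \<in> prim n X h}"

definition prim_sum_direct :: "nat \<Rightarrow> 'a :: field mat \<Rightarrow> 'a poly \<Rightarrow> bool" where
  "prim_sum_direct n X a \<longleftrightarrow> (\<forall>f. (\<forall>h. monic_irred h \<and> h dvd a \<longrightarrow> f h \<in> prim n X h) \<and>
       finsum_vec TYPE('a) n f {h. monic_irred h \<and> h dvd a} = 0\<^sub>v n \<longrightarrow>
       (\<forall>h. monic_irred h \<and> h dvd a \<longrightarrow> f h = 0\<^sub>v n))"

end

theory Submission
  imports Defs "HOL-Library.Cardinality"
begin

text \<open>Write \<open>al(h)\<close> and \<open>nu(h)\<close> for the exponents of a monic irreducible \<open>h\<close> in \<open>ord(v)\<close> and in
  \<open>c\<^sub>X\<close>.  The space \<open>V(h)\<close> has \<open>q ^ (nu(h) deg h)\<close> elements and \<open>v F[X]\<close> has \<open>q ^ deg (ord v)\<close>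
  elements; comparing cardinalities of the \<open>h\<close>-parts, \<open>V(h) \<subseteq> v F[X]\<close> if and only if
  \<open>al(h) = nu(h)\<close>, and then \<open>V(h)\<close> is cyclic.  The loop strips from \<open>ord(v)\<close> exactly those \<open>h\<close>
  with \<open>al(h) < nu(h)\<close>: in round \<open>k + 1\<close> the exponent of \<open>h\<close> in \<open>d\<close> is
  \<open>2 ^ k (nu(h) - al(h))\<close>, capped by the exponent of \<open>h\<close> in \<open>a\<close>, so that
  logarithmically many rounds suffice.\<close>

section \<open>The action of polynomials on row vectors\<close>

text \<open>Dimensions are measured by counting: a space with D coordinates over the field has q ^ D
  elements. The obstacle is the size of V(h), because c_X is defined by a determinant and V(h) as a
  kernel. Two facts bridge the gap: c_X annihilates V, and a matrix annihilated by p has a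
  characteristic polynomial dividing a power of p.

  In the loop, multiplying e by gcd(a/e, e) turns an exponent x of d into 2 x, capped by the
  exponent left in a; a defect 0 stays 0. The amounts removed form a geometric series, so before
  round i a prime h has lost (2 ^ (i - 1) - 1) (nu(h) - al(h)), as far as al(h) permits. Since al(h)
  <= n, no prime with al(h) < nu(h) is left once 2 ^ (i - 1) > n. This holds for i = floor(log2 n) +
  2, which is the origin of the constant 2.

  If V(h) is not cyclic, then al(h) < nu(h) is forced. Hence the condition in (3) over the f-cyclic
  h agrees with the same condition over all h dividing c_X.\<close>

lemma smult_vec_zero [simp]: "c \<cdot>\<^sub>v 0\<^sub>v n = (0\<^sub>v n :: 'a :: comm_ring_1 vec)"
  by (intro eq_vecI) auto

lemma zero_smult_vec [simp]:
  "v \<in> carrier_vec n \<Longrightarrow> 0 \<cdot>\<^sub>v v = (0\<^sub>v n :: 'a :: comm_ring_1 vec)"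
  by (intro eq_vecI) auto

lemma vmul_carrier [simp]:
  "X \<in> carrier_mat m n \<Longrightarrow> vmul v X \<in> carrier_vec n"
  unfolding vmul_def carrier_vec_def by auto

lemma vmul_assoc:
  fixes A B :: "'a :: comm_ring_1 mat"
  assumes "A \<in> carrier_mat m k" "B \<in> carrier_mat k n" "v \<in> carrier_vec m"
  shows "vmul (vmul v A) B = vmul v (A * B)"
  unfolding vmul_def
  using assms by (simp add: transpose_mult assoc_mult_mat_vec[of _ n k _ m])

lemma vmul_add_vec:
  fixes A :: "'a :: comm_ring_1 mat"
  assumes "A \<in> carrier_mat m n" "v \<in> carrier_vec m" "w \<in> carrier_vec m"
  shows "vmul (v + w) A = vmul v A + vmul w A"
  unfolding vmul_def using assms by (simp add: mult_add_distrib_mat_vec[of _ n m])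

lemma vmul_smult_vec:
  fixes A :: "'a :: comm_ring_1 mat"
  assumes "A \<in> carrier_mat m n" "v \<in> carrier_vec m"
  shows "vmul (c \<cdot>\<^sub>v v) A = c \<cdot>\<^sub>v vmul v A"
  unfolding vmul_def using assms by (intro eq_vecI) auto

lemma vmul_zero_vec [simp]:
  fixes A :: "'a :: comm_ring_1 mat"
  assumes "A \<in> carrier_mat m n"
  shows "vmul (0\<^sub>v m) A = 0\<^sub>v n"
  unfolding vmul_def using assms by (intro eq_vecI) auto

lemma vmul_add_mat:
  fixes A B :: "'a :: comm_ring_1 mat"
  assumes "A \<in> carrier_mat m n" "B \<in> carrier_mat m n" "v \<in> carrier_vec m"
  shows "vmul v (A + B) = vmul v A + vmul v B"
  unfolding vmul_def using assms
  by (simp add: transpose_add[of _ m n] add_mult_distrib_mat_vec[of _ n m])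

lemma vmul_smult_one:
  fixes v :: "'a :: comm_ring_1 vec"
  assumes "v \<in> carrier_vec n"
  shows "vmul v (c \<cdot>\<^sub>m 1\<^sub>m n) = c \<cdot>\<^sub>v v"
proof -
  have "transpose_mat (c \<cdot>\<^sub>m 1\<^sub>m n) = c \<cdot>\<^sub>m (1\<^sub>m n :: 'a mat)"
    by (rule eq_matI) auto
  then show ?thesis using assms unfolding vmul_def
    by (intro eq_vecI) (auto simp: row_def scalar_prod_def sum.remove)
qed

lemma vmul_unit_vec:
  fixes A :: "'a :: comm_ring_1 mat"
  assumes "A \<in> carrier_mat m n" "i < m"
  shows "vmul (unit_vec m i) A = row A i"
  unfolding vmul_def using assms by (intro eq_vecI) auto

lemma poly_mat_pCons:
  fixes X :: "'a :: comm_ring_1 mat"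
  assumes "X \<in> carrier_mat n n"
  shows "poly_mat n (pCons c p) X = c \<cdot>\<^sub>m 1\<^sub>m n + X * poly_mat n p X"
proof (cases "c = 0 \<and> p = 0")
  case True
  then show ?thesis using assms unfolding poly_mat_def by (intro eq_matI) auto
next
  case False
  then show ?thesis unfolding poly_mat_def by (cases "p = 0") auto
qed

lemma poly_mat_carrier [simp]:
  fixes X :: "'a :: comm_ring_1 mat"
  assumes "X \<in> carrier_mat n n"
  shows "poly_mat n p X \<in> carrier_mat n n"
proof (induction p)
  case 0
  then show ?case unfolding poly_mat_def by simp
next
  case (pCons c p)
  then show ?case using assms by (simp add: poly_mat_pCons)
qed

lemma vact_carrier [simp]:
  "X \<in> carrier_mat n n \<Longrightarrow> vact n w p X \<in> carrier_vec n"
  unfolding vact_def using vmul_carrier[OF poly_mat_carrier] .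

lemma vact_0 [simp]:
  "w \<in> carrier_vec n \<Longrightarrow> vact n w 0 X = 0\<^sub>v n"
  unfolding vact_def poly_mat_def vmul_def by (intro eq_vecI) auto

text \<open>\<open>poly_mat\<close> is a Horner scheme with \<open>X\<close> as left factor, and a
  row vector meets that factor first. Splitting off a coefficient therefore replaces
  \<open>w\<close> by \<open>vmul w X\<close>, so inductions on the polynomial generalise over the
  vector.\<close>

lemma vact_pCons:
  assumes "X \<in> carrier_mat n n" "w \<in> carrier_vec n"
  shows "vact n w (pCons c p) X = c \<cdot>\<^sub>v w + vact n (vmul w X) p X"
  unfolding vact_def using assms
  by (simp add: poly_mat_pCons vmul_add_mat[of _ n n] vmul_smult_one vmul_assoc[of _ n n _ n])

lemma vact_add_vec:
  assumes "X \<in> carrier_mat n n" "v \<in> carrier_vec n" "w \<in> carrier_vec n"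
  shows "vact n (v + w) p X = vact n v p X + vact n w p X"
  unfolding vact_def by (rule vmul_add_vec[OF poly_mat_carrier]) (use assms in auto)

lemma vact_smult_vec:
  assumes "X \<in> carrier_mat n n" "v \<in> carrier_vec n"
  shows "vact n (c \<cdot>\<^sub>v v) p X = c \<cdot>\<^sub>v vact n v p X"
  unfolding vact_def by (rule vmul_smult_vec[OF poly_mat_carrier]) (use assms in auto)

lemma vact_zero_vec [simp]:
  fixes X :: "'a :: comm_ring_1 mat"
  assumes "X \<in> carrier_mat n n"
  shows "vact n (0\<^sub>v n) p X = 0\<^sub>v n"
  using vact_smult_vec[OF assms, of "0\<^sub>v n" 0 p] vact_carrier[OF assms, of "0\<^sub>v n" p]
  by simp

lemma vact_add_poly:
  assumes "X \<in> carrier_mat n n" "w \<in> carrier_vec n"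
  shows "vact n w (p + r) X = vact n w p X + vact n w r X"
  using assms(2)
proof (induction p r arbitrary: w rule: poly_induct2)
  case 0
  then show ?case using assms by simp
next
  case (pCons a p b q)
  then show ?case using assms(1)
    by (simp add: vact_pCons add_smult_distrib_vec comm_add_vec assoc_add_vec) 
      (intro eq_vecI, auto)
qed

lemma vact_smult_poly:
  assumes "X \<in> carrier_mat n n" "w \<in> carrier_vec n"
  shows "vact n w (Polynomial.smult c p) X = c \<cdot>\<^sub>v vact n w p X"
  using assms(2)
proof (induction p arbitrary: w)
  case 0
  then show ?case by simp
next
  case (pCons a p)
  then show ?case using assms(1)
    by (simp add: vact_pCons smult_add_distrib_vec[of _ n] smult_smult_assoc)
qed

lemma vact_1 [simp]:
  assumes "X \<in> carrier_mat n n" "w \<in> carrier_vec n"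
  shows "vact n w 1 X = w"
  using assms by (simp add: one_pCons vact_pCons)

lemma vact_vmul:
  assumes "X \<in> carrier_mat n n" "w \<in> carrier_vec n"
  shows "vact n (vmul w X) p X = vmul (vact n w p X) X"
  using assms(2)
proof (induction p arbitrary: w)
  case 0
  then show ?case using assms(1) by simp
next
  case (pCons a p)
  then show ?case using assms(1)
    by (simp add: vact_pCons vmul_add_vec[of _ n n] vmul_smult_vec[of _ n n])
qed

lemma vact_mult:
  assumes "X \<in> carrier_mat n n" "w \<in> carrier_vec n"
  shows "vact n w (p * r) X = vact n (vact n w p X) r X"
  using assms(2)
proof (induction p arbitrary: w)
  case 0
  then show ?case using assms(1) by simp
next
  case (pCons a p)
  have "vact n w (pCons a p * r) X = a \<cdot>\<^sub>v vact n w r X + vact n w (pCons 0 (p * r)) X"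
    using assms(1) pCons.prems by (simp add: vact_add_poly vact_smult_poly)
  also have "vact n w (pCons 0 (p * r)) X = vact n (vact n (vmul w X) p X) r X"
    using assms(1) pCons by (simp add: vact_pCons)
  finally show ?case using assms(1) pCons.prems
    by (simp add: vact_pCons vact_add_vec vact_smult_vec)
qed

lemma vact_minus_poly:
  assumes "X \<in> carrier_mat n n" "w \<in> carrier_vec n"
  shows "vact n w (p - r) X = vact n w p X - vact n w r X"
  using vact_add_poly[OF assms, of p "Polynomial.smult (-1) r"] vact_smult_poly[OF assms, of "-1" r] assms
  by (intro eq_vecI) auto

section \<open>The Cayley--Hamilton theorem and orders of vectors\<close>

text \<open>Unit vectors pick out the rows. In this way the module laws for \<open>vact\<close>
  become identities between matrices.\<close>

lemma eq_mat_vmulI: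
  fixes A B :: "'a :: comm_ring_1 mat"
  assumes "A \<in> carrier_mat m n" "B \<in> carrier_mat m n"
    and "\<And>v. v \<in> carrier_vec m \<Longrightarrow> vmul v A = vmul v B"
  shows "A = B"
proof (rule eq_rowI)
  fix i assume "i < dim_row B"
  then have i: "i < m" using assms by simp
  show "row A i = row B i"
    using assms(3)[of "unit_vec m i"] vmul_unit_vec[OF assms(1) i] vmul_unit_vec[OF assms(2) i] by simp
qed (use assms in auto)

lemma poly_mat_0 [simp]: "poly_mat n 0 X = 0\<^sub>m n n"
  unfolding poly_mat_def by simp

lemma poly_mat_mult:
  fixes X :: "'a :: comm_ring_1 mat"
  assumes X: "X \<in> carrier_mat n n"
  shows "poly_mat n (p * r) X = poly_mat n p X * poly_mat n r X"
proof (rule eq_mat_vmulI[where m = n and n = n])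
  fix v :: "'a vec" assume v: "v \<in> carrier_vec n"
  show "vmul v (poly_mat n (p * r) X) = vmul v (poly_mat n p X * poly_mat n r X)"
    using vact_mult[OF X v, of p r] X v
    by (simp add: vact_def vmul_assoc[of _ n n _ n])
qed (use X in \<open>auto intro: mult_carrier_mat[of _ n n _ n]\<close>)

lemma poly_mat_add:
  fixes X :: "'a :: comm_ring_1 mat"
  assumes X: "X \<in> carrier_mat n n"
  shows "poly_mat n (p + r) X = poly_mat n p X + poly_mat n r X"
proof (rule eq_mat_vmulI[where m = n and n = n])
  fix v :: "'a vec" assume v: "v \<in> carrier_vec n"
  show "vmul v (poly_mat n (p + r) X) = vmul v (poly_mat n p X + poly_mat n r X)"
    using vact_add_poly[OF X v, of p r] X v
    by (simp add: vact_def vmul_add_mat[of _ n n])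
qed (use X in auto)

lemma index_poly_mat_sum:
  fixes X :: "'a :: comm_ring_1 mat"
  assumes X: "X \<in> carrier_mat n n" and "finite S" "i < n" "j < n"
  shows "poly_mat n (sum f S) X $$ (i, j) = (\<Sum>l\<in>S. poly_mat n (f l) X $$ (i, j))"
  using assms(2)
proof induction
  case empty
  then show ?case using assms by simp
next
  case (insert l S)
  have "dim_row (poly_mat n (sum f S) X) = n" "dim_col (poly_mat n (sum f S) X) = n"
    using poly_mat_carrier[OF X] by auto
  then show ?case using insert assms by (simp add: poly_mat_add[OF X])
qed

theorem cayley_hamilton:
  fixes X :: "'a :: comm_ring_1 mat"
  assumes X: "X \<in> carrier_mat n n"
  shows "poly_mat n (char_poly X) X = 0\<^sub>m n n"
proof (rule eq_matI)
  \<comment> \<open>Row \<open>l\<close> of \<open>t I - X\<close> is the relation \<open>e\<^sub>l t = \<Sum>\<^sub>i X\<^sub>l\<^sub>i e\<^sub>i\<close> between the unit vectors (\<open>row_M\<close>);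
    multiplying by the adjugate gives \<open>e\<^sub>k c\<^sub>X = 0\<close>.\<close>
  fix k j assume "k < dim_row (0\<^sub>m n n :: 'a mat)" "j < dim_col (0\<^sub>m n n :: 'a mat)"
  then have k: "k < n" and j: "j < n" by auto
  let ?M = "char_poly_matrix X" and ?P = "\<lambda>p. poly_mat n p X"
  let ?A = "adj_mat ?M"
  have M: "?M \<in> carrier_mat n n" using X by simp
  note A = adj_mat[OF M]
  have dP: "dim_row (?P p) = n" "dim_col (?P p) = n" for p
    using poly_mat_carrier[OF X] by auto
  have row_M: "(\<Sum>i<n. ?P (?M $$ (l, i)) $$ (i, m)) = 0" if l: "l < n" and m: "m < n" for l m
  proof -
    have "?P (?M $$ (l, i)) $$ (i, m)
        = (if i = m then - X $$ (l, i) else 0) + (if i = l then X $$ (i, m) else 0)"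
      if i: "i < n" for i
    proof -
      have e: "?M $$ (l, i) = [: - X $$ (l, i), if l = i then 1 else 0 :]"
        using l i X unfolding char_poly_matrix_def by auto
      have one: "(1 :: 'a) \<cdot>\<^sub>m 1\<^sub>m n = 1\<^sub>m n" "(0 :: 'a) \<cdot>\<^sub>m 1\<^sub>m n = 0\<^sub>m n n" by (auto intro!: eq_matI)
      show ?thesis unfolding e using l i m X
        by (auto simp: poly_mat_pCons[OF X] one)
    qed
    then have "(\<Sum>i<n. ?P (?M $$ (l, i)) $$ (i, m)) =
        (\<Sum>i<n. (if i = m then - X $$ (l, i) else 0) + (if i = l then X $$ (i, m) else 0))"
      by (intro sum.cong) auto
    also have "\<dots> = 0" using l m by (simp add: sum.distrib)
    finally show ?thesis .
  qed
  \<comment> \<open>The adjugate times \<open>?M\<close> is c_X times the identity, so only the term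
    \<open>i = k\<close> survives.\<close>
  have "?P (char_poly X) $$ (k, j) = (\<Sum>i<n. ?P ((?A * ?M) $$ (k, i)) $$ (i, j))"
  proof -
    have "?P ((?A * ?M) $$ (k, i)) $$ (i, j) = (if i = k then ?P (char_poly X) $$ (k, j) else 0)"
      if "i < n" for i
      using that k j unfolding A(3) char_poly_def by auto
    then show ?thesis using k by simp
  qed
  also have "\<dots> = (\<Sum>i<n. \<Sum>l<n. ?P (?M $$ (l, i) * ?A $$ (k, l)) $$ (i, j))"
  proof (intro sum.cong refl)
    fix i assume "i \<in> {..<n}"
    then have i: "i < n" by simp
    \<comment> \<open>The entries of \<open>?M\<close> are written as left factors, so that after
      \<open>poly_mat_mult\<close> and two exchanges of sums the inner sum over \<open>i\<close> is
      the one that vanishes by \<open>row_M\<close>.\<close>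
    have "(?A * ?M) $$ (k, i) = (\<Sum>l<n. ?M $$ (l, i) * ?A $$ (k, l))"
      using A(1) M k i by (auto simp: scalar_prod_def mult.commute atLeast0LessThan intro!: sum.cong)
    show "?P ((?A * ?M) $$ (k, i)) $$ (i, j) = (\<Sum>l<n. ?P (?M $$ (l, i) * ?A $$ (k, l)) $$ (i, j))"
      unfolding \<open>(?A * ?M) $$ (k, i) = _\<close> by (rule index_poly_mat_sum[OF X _ i j]) simp
  qed
  also have "\<dots> = (\<Sum>i<n. \<Sum>l<n. \<Sum>m<n. ?P (?M $$ (l, i)) $$ (i, m) * ?P (?A $$ (k, l)) $$ (m, j))"
    using j dP by (intro sum.cong refl) (auto simp: poly_mat_mult[OF X] scalar_prod_def atLeast0LessThan intro!: sum.cong)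
  also have "\<dots> = (\<Sum>l<n. \<Sum>i<n. \<Sum>m<n. ?P (?M $$ (l, i)) $$ (i, m) * ?P (?A $$ (k, l)) $$ (m, j))"
    by (rule sum.swap)
  also have "\<dots> = (\<Sum>l<n. \<Sum>m<n. \<Sum>i<n. ?P (?M $$ (l, i)) $$ (i, m) * ?P (?A $$ (k, l)) $$ (m, j))"
    by (rule sum.cong[OF refl]) (rule sum.swap)
  also have "\<dots> = 0"
    using row_M by (simp flip: sum_distrib_right)
  finally show "?P (char_poly X) $$ (k, j) = 0\<^sub>m n n $$ (k, j)" using k j by simp
qed (use poly_mat_carrier[OF X, of "char_poly X"] in auto)

text \<open>The polynomial matrix \<open>p(t) I - p(A)\<close> is a multiple of \<open>t I - A\<close>; take determinants.\<close>
lemma char_poly_dvd_power_annihilator: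
  fixes A :: "'a :: idom mat"
  assumes A: "A \<in> carrier_mat m m" and p: "poly_mat m p A = 0\<^sub>m m m"
  shows "char_poly A dvd p ^ m"
proof -
  let ?C = "map_mat (\<lambda>c :: 'a. [:c:])" and ?M = "char_poly_matrix A"
  have M: "?M \<in> carrier_mat m m" using A by simp
  interpret const: semiring_hom "\<lambda>c :: 'a. [:c:]"
    by unfold_locales (auto simp: one_pCons)
  have hom: "?C (B * D) = ?C B * ?C D" if "B \<in> carrier_mat m m" "D \<in> carrier_mat m m" for B D :: "'a mat"
    by (rule const.mat_hom_mult[OF that])
  have "\<exists>Q \<in> carrier_mat m m. p \<cdot>\<^sub>m 1\<^sub>m m - ?C (poly_mat m p A) = ?M * Q"
  proof (induction p)
    case 0
    show ?case using M by (intro bexI[of _ "0\<^sub>m m m"] eq_matI) auto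
  next
    case (pCons c p)
    then obtain Q where Q: "Q \<in> carrier_mat m m" "p \<cdot>\<^sub>m 1\<^sub>m m - ?C (poly_mat m p A) = ?M * Q" by blast
    let ?P = "poly_mat m p A"
    have P: "?P \<in> carrier_mat m m" using A by simp
    \<comment> \<open>With M = t I - A and M Q = p I - p(A), the quotient for c + t p is t Q + p(A):
      M (t Q + p(A)) = t p I - A p(A), while c I occurs in both terms of the required difference and
      cancels.\<close>
    have "?M * ([:0,1:] \<cdot>\<^sub>m Q + ?C ?P) = ?M * ([:0,1:] \<cdot>\<^sub>m Q) + ?M * ?C ?P"
      using M Q P by (intro mult_add_distrib_mat[of _ m m _ m]) auto
    also have "?M * ([:0,1:] \<cdot>\<^sub>m Q) = [:0,1:] \<cdot>\<^sub>m (?M * Q)"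
      using M Q by (intro mult_smult_distrib[of _ m m _ m]) auto
    also have "?M * Q = p \<cdot>\<^sub>m 1\<^sub>m m - ?C ?P" by (simp add: Q)
    finally have 1: "?M * ([:0,1:] \<cdot>\<^sub>m Q + ?C ?P) =
        [:0,1:] \<cdot>\<^sub>m (p \<cdot>\<^sub>m 1\<^sub>m m - ?C ?P) + ?M * ?C ?P" .
    have "?M = [:0,1:] \<cdot>\<^sub>m 1\<^sub>m m + (- 1) \<cdot>\<^sub>m ?C A"
      using A unfolding char_poly_matrix_def by (intro eq_matI) auto
    then have "?M * ?C ?P = [:0,1:] \<cdot>\<^sub>m 1\<^sub>m m * ?C ?P + (- 1) \<cdot>\<^sub>m ?C A * ?C ?P"
      using A P by (auto intro!: add_mult_distrib_mat[of _ m m _ _ m])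
    also have "[:0,1:] \<cdot>\<^sub>m 1\<^sub>m m * ?C ?P = [:0,1:] \<cdot>\<^sub>m ?C ?P"
      using P by (subst mult_smult_assoc_mat[of _ m m _ m]) auto
    also have "(- 1) \<cdot>\<^sub>m ?C A * ?C ?P = (- 1) \<cdot>\<^sub>m ?C (A * ?P)"
      using P A by (subst mult_smult_assoc_mat[of _ m m _ m]) (auto simp: hom)
    finally have 2: "?M * ?C ?P = [:0,1:] \<cdot>\<^sub>m ?C ?P + (- 1) \<cdot>\<^sub>m ?C (A * ?P)" .
    have AP: "A * ?P \<in> carrier_mat m m" using A P by (rule mult_carrier_mat)
    have "?M * ([:0,1:] \<cdot>\<^sub>m Q + ?C ?P) =
        pCons c p \<cdot>\<^sub>m 1\<^sub>m m - ?C (poly_mat m (pCons c p) A)"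
      unfolding 1 2 poly_mat_pCons[OF A] using P AP
      by (intro eq_matI) (auto simp del: index_mult_mat(1))
    then show ?case using Q P by (intro bexI[of _ "[:0,1:] \<cdot>\<^sub>m Q + ?C ?P"]) auto
  qed
  then obtain Q where Q: "Q \<in> carrier_mat m m" "p \<cdot>\<^sub>m 1\<^sub>m m - ?C (poly_mat m p A) = ?M * Q" by blast
  have "p \<cdot>\<^sub>m 1\<^sub>m m - ?C (poly_mat m p A) = p \<cdot>\<^sub>m 1\<^sub>m m"
    unfolding p by (intro eq_matI) auto
  then have "p ^ m = det (?M * Q)" using Q by (metis det_smult det_one index_one_mat(3) mult.right_neutral)
  also have "\<dots> = char_poly A * det Q" unfolding char_poly_def by (rule det_mult[OF M Q(1)])
  finally show ?thesis by simp
qed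

lemma vact_char_poly:
  assumes "X \<in> carrier_mat n n" "w \<in> carrier_vec n"
  shows "vact n w (char_poly X) X = 0\<^sub>v n"
  unfolding vact_def cayley_hamilton[OF assms(1)] using assms
  by (auto simp: vmul_def intro!: eq_vecI)

lemma monic_char_poly: "X \<in> carrier_mat n n \<Longrightarrow> monic (char_poly X)"
  using degree_monic_char_poly by metis

lemma degree_char_poly: "X \<in> carrier_mat n n \<Longrightarrow> degree (char_poly X) = n"
  using degree_monic_char_poly by metis

text \<open>By Cayley-Hamilton \<open>char_poly X\<close> is a monic annihilator, so one of least
  degree exists and the choice in \<open>ordX\<close> is made from a nonempty set.\<close>

lemma ordX_least:
  fixes X :: "'a :: field mat"
  assumes "X \<in> carrier_mat n n" "w \<in> carrier_vec n"
  shows monic_ordX: "monic (ordX n X w)"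
    and vact_ordX: "vact n w (ordX n X w) X = 0\<^sub>v n"
    and degree_ordX_le: "monic b \<Longrightarrow> vact n w b X = 0\<^sub>v n \<Longrightarrow> degree (ordX n X w) \<le> degree b"
proof -
  let ?Q = "\<lambda>a. monic a \<and> vact n w a X = 0\<^sub>v n"
  have "?Q (char_poly X)" using assms vact_char_poly monic_char_poly by blast
  from ex_has_least_nat[of ?Q, OF this, of degree]
  have "\<exists>a. monic a \<and> vact n w a X = 0\<^sub>v n \<and>
       (\<forall>b. monic b \<and> vact n w b X = 0\<^sub>v n \<longrightarrow> degree a \<le> degree b)" by blast
  from someI_ex[OF this, folded ordX_def]
  show "monic (ordX n X w)" "vact n w (ordX n X w) X = 0\<^sub>v n"
    "monic b \<Longrightarrow> vact n w b X = 0\<^sub>v n \<Longrightarrow> degree (ordX n X w) \<le> degree b" by blast+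
qed

text \<open>A nonzero remainder of \<open>b\<close> modulo the order, scaled to be monic, would
  annihilate \<open>w\<close> in smaller degree.\<close>

lemma ordX_dvd_iff:
  fixes X :: "'a :: field mat"
  assumes "X \<in> carrier_mat n n" "w \<in> carrier_vec n"
  shows "ordX n X w dvd b \<longleftrightarrow> vact n w b X = 0\<^sub>v n"
proof
  assume "ordX n X w dvd b"
  then show "vact n w b X = 0\<^sub>v n"
    using assms by (auto elim!: dvdE simp: vact_mult vact_ordX)
next
  assume b: "vact n w b X = 0\<^sub>v n"
  let ?a = "ordX n X w" and ?r = "b mod ordX n X w"
  have a0: "?a \<noteq> 0" using monic_ordX[OF assms] by auto
  have "b = ?a * (b div ?a) + ?r" by simp
  then have "vact n w b X = vact n w (?a * (b div ?a)) X + vact n w ?r X"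
    using assms by (metis vact_add_poly)
  then have r: "vact n w ?r X = 0\<^sub>v n"
    using assms b by (simp add: vact_mult vact_ordX)
  have "?r = 0"
  proof (rule ccontr)
    assume r0: "?r \<noteq> 0"
    let ?s = "Polynomial.smult (inverse (lead_coeff ?r)) ?r"
    have "monic ?s" using r0 by simp
    moreover have "vact n w ?s X = 0\<^sub>v n" using assms r by (simp add: vact_smult_poly)
    ultimately have "degree ?a \<le> degree ?s" using assms by (rule_tac degree_ordX_le)
    also have "\<dots> = degree ?r" using r0 by simp
    finally show False using degree_mod_less[OF a0, of b] r0 by simp
  qed
  then show "?a dvd b" by (simp add: mod_eq_0_iff_dvd)
qed

lemma ordX_eqI:
  fixes X :: "'a :: field mat"
  assumes "X \<in> carrier_mat n n" "w \<in> carrier_vec n" "monic a"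
    and "\<And>b. a dvd b \<longleftrightarrow> vact n w b X = 0\<^sub>v n"
  shows "ordX n X w = a"
proof (rule poly_dvd_antisym)
  show "ordX n X w dvd a" using assms(4)[of a] ordX_dvd_iff[OF assms(1,2), of a] by simp
  show "a dvd ordX n X w" using assms(4) vact_ordX[OF assms(1,2)] by blast
  show "lead_coeff (ordX n X w) = lead_coeff a" using assms(3) monic_ordX[OF assms(1,2)] by simp
qed

lemma ordX_dvd_char_poly:
  fixes X :: "'a :: field mat"
  assumes "X \<in> carrier_mat n n" "w \<in> carrier_vec n"
  shows "ordX n X w dvd char_poly X"
  using assms by (simp add: ordX_dvd_iff vact_char_poly)

lemma ordX_eq_1_iff:
  fixes X :: "'a :: field mat"
  assumes "X \<in> carrier_mat n n" "w \<in> carrier_vec n"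
  shows "ordX n X w = 1 \<longleftrightarrow> w = 0\<^sub>v n"
proof -
  have "ordX n X w = 1 \<longleftrightarrow> ordX n X w dvd 1"
    using monic_ordX[OF assms] poly_dvd_antisym[of "ordX n X w" 1] by force
  then show ?thesis using assms ordX_dvd_iff[OF assms, of 1] by simp
qed

text \<open>\<open>b\<close> kills the new vector exactly when g a divides g b. Every vector
  \<open>u\<close> of the loop has this form, which is why the loop need not compute an order
  again.\<close>

lemma ordX_vact:
  fixes X :: "'a :: field mat"
  assumes "X \<in> carrier_mat n n" "w \<in> carrier_vec n" "ordX n X w = g * a" "monic g"
  shows "ordX n X (vact n w g X) = a"
proof (rule ordX_eqI)
  show "monic a" using monic_ordX[OF assms(1,2)] assms(3,4) by (simp add: lead_coeff_mult)
  have "g \<noteq> 0" using assms(4) by auto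
  then show "a dvd b \<longleftrightarrow> vact n (vact n w g X) b X = 0\<^sub>v n" for b
    using ordX_dvd_iff[OF assms(1,2), of "g * b"] assms by (simp add: vact_mult)
qed (use assms in auto)

section \<open>Counting vectors\<close>

lemma card_carrier_vec: "card (carrier_vec m :: 'a :: finite vec set) = CARD('a) ^ m"
proof -
  have "bij_betw list_of_vec (carrier_vec m :: 'a vec set) {xs. set xs \<subseteq> UNIV \<and> length xs = m}"
    by (rule bij_betw_byWitness[where f' = vec_of_list])
      (auto simp: vec_list list_vec intro!: carrier_vecI)
  from bij_betw_same_card[OF this] show ?thesis
    using card_lists_length_eq[of "UNIV :: 'a set" m] by simp
qed

lemma finite_carrier_vec: "finite (carrier_vec m :: 'a :: finite vec set)"
  by (rule card_ge_0_finite) (simp add: card_carrier_vec)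

lemma CARD_field_gt_1: "1 < CARD('a :: {finite, field})"
  using card_mono[of "UNIV :: 'a set" "{0, 1}"] by simp

lemma cyc_carrier: "X \<in> carrier_mat n n \<Longrightarrow> cyc n X w \<subseteq> carrier_vec n"
  unfolding cyc_def by auto

text \<open>Each element of the cyclic space comes from exactly one remainder modulo the order.
  Remainders are coded as coefficient lists of length \<open>degree a\<close>, which are easy to
  count.\<close>

lemma card_cyc:
  fixes X :: "'a :: {finite, field} mat"
  assumes X: "X \<in> carrier_mat n n" and w: "w \<in> carrier_vec n"
  shows "card (cyc n X w) = CARD('a) ^ degree (ordX n X w)"
proof -
  define a where "a = ordX n X w"
  define L where "L = {xs :: 'a list. set xs \<subseteq> UNIV \<and> length xs = degree a}"
  have a0: "a \<noteq> 0" using monic_ordX[OF X w] unfolding a_def by auto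
  \<comment> \<open>\<open>Poly\<close> drops trailing zeros, but \<open>nth_default\<close> reads 0
    past the end, so the list entries are the coefficients even if the polynomial has smaller
    degree.\<close>
  have c: "coeff (Poly xs) i = (if i < degree a then xs ! i else 0)" if "xs \<in> L" for xs i
    using that by (auto simp: nth_default_def L_def)
  have "bij_betw (\<lambda>xs. vact n w (Poly xs) X) L (cyc n X w)"
    unfolding bij_betw_def
  proof
    show "inj_on (\<lambda>xs. vact n w (Poly xs) X) L"
    proof (rule inj_onI)
      fix xs ys assume L: "xs \<in> L" "ys \<in> L" and eq: "vact n w (Poly xs) X = vact n w (Poly ys) X"
      let ?d = "Poly xs - Poly ys"
      have "vact n w ?d X = 0\<^sub>v n" using X w eq by (simp add: vact_minus_poly)
      then have "a dvd ?d" using ordX_dvd_iff[OF X w] unfolding a_def by simp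
      moreover have "degree ?d < degree a" if "?d \<noteq> 0"
      proof (rule ccontr)
        assume "\<not> degree ?d < degree a"
        then have "coeff ?d (degree ?d) = 0" unfolding coeff_diff using c[OF L(1), of "degree ?d"] c[OF L(2), of "degree ?d"]
            \<open>\<not> degree ?d < degree a\<close> by simp
        then show False using that leading_coeff_neq_0 by blast
      qed
      ultimately have "?d = 0" using dvd_imp_degree_le leD by blast
      then have "coeff (Poly xs) i = coeff (Poly ys) i" for i by simp
      then have "xs ! i = ys ! i" if "i < degree a" for i
        using c[OF L(1), of i] c[OF L(2), of i] that by simp
      then show "xs = ys" using L unfolding L_def by (auto intro: nth_equalityI)
    qed
    show "(\<lambda>xs. vact n w (Poly xs) X) ` L = cyc n X w"
    proof
      show "(\<lambda>xs. vact n w (Poly xs) X) ` L \<subseteq> cyc n X w" unfolding cyc_def by blast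
      show "cyc n X w \<subseteq> (\<lambda>xs. vact n w (Poly xs) X) ` L"
      proof
        fix u assume "u \<in> cyc n X w"
        then obtain p where p: "u = vact n w p X" unfolding cyc_def by blast
        let ?r = "p mod a"
        have "p = a * (p div a) + ?r" by simp
        then have "u = vact n w (a * (p div a)) X + vact n w ?r X"
          unfolding p using X w by (metis vact_add_poly)
        then have u: "u = vact n w ?r X"
          using X w vact_ordX[OF X w] by (simp add: vact_mult a_def)
        let ?xs = "map (coeff ?r) [0..<degree a]"
        have L: "?xs \<in> L" unfolding L_def by simp
        have "coeff ?r i = 0" if "\<not> i < degree a" for i
          using degree_mod_less[OF a0, of p] that by (auto intro: coeff_eq_0)
        then have "Poly ?xs = ?r"
          by (intro poly_eqI) (auto simp: nth_default_def)
        then show "u \<in> (\<lambda>xs. vact n w (Poly xs) X) ` L" using L u by (auto intro!: image_eqI[of _ _ ?xs])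
      qed
    qed
  qed
  then show ?thesis
    using bij_betw_same_card card_lists_length_eq[of "UNIV :: 'a set" "degree a"]
    unfolding L_def a_def by fastforce
qed

section \<open>Coordinates for subspaces of V\<close>

lemma index_vmul:
  fixes A :: "'a :: comm_ring_1 mat"
  assumes "A \<in> carrier_mat m n" "j < n"
  shows "vmul y A $ j = col A j \<bullet> y"
  unfolding vmul_def using assms by simp

text \<open>Stacking matrices adds row combinations. It is used to adjoin a vector to a basis and to
  join the bases of two kernels.\<close>

lemma vmul_append_rows:
  fixes A B :: "'a :: comm_ring_1 mat"
  assumes A: "A \<in> carrier_mat m n" and B: "B \<in> carrier_mat k n"
    and y: "y \<in> carrier_vec m" and z: "z \<in> carrier_vec k"
  shows "vmul (y @\<^sub>v z) (A @\<^sub>r B) = vmul y A + vmul z B"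
proof (rule eq_vecI)
  have AB: "A @\<^sub>r B \<in> carrier_mat (m + k) n" using A B by simp
  note d = carrier_vecD[OF vmul_carrier]
  fix j assume "j < dim_vec (vmul y A + vmul z B)"
  then have j: "j < n" using d[OF B] by simp
  have "col (A @\<^sub>r B) j = col A j @\<^sub>v col B j"
    unfolding append_rows_def
    by (rule col_four_block_mat) (use A B j in auto)
  moreover have "(col A j @\<^sub>v col B j) \<bullet> (y @\<^sub>v z) = col A j \<bullet> y + col B j \<bullet> z"
    by (rule scalar_prod_append) (use A B y z in auto)
  ultimately show "vmul (y @\<^sub>v z) (A @\<^sub>r B) $ j = (vmul y A + vmul z B) $ j"
    using j d[OF B] index_vmul[OF AB j] index_vmul[OF A j] index_vmul[OF B j] by simp
next
  show "dim_vec (vmul (y @\<^sub>v z) (A @\<^sub>r B)) = dim_vec (vmul y A + vmul z B)"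
    using vmul_carrier[OF carrier_append_rows[OF A B]] vmul_carrier[OF A] vmul_carrier[OF B]
    by (metis add_carrier_vec carrier_vecD)
qed

lemma vmul_diff_vec:
  fixes A :: "'a :: comm_ring_1 mat"
  assumes A: "A \<in> carrier_mat m n" and "v \<in> carrier_vec m" "w \<in> carrier_vec m"
  shows "vmul (v - w) A = vmul v A - vmul w A"
proof -
  have "v - w = v + (-1) \<cdot>\<^sub>v w" using assms by (intro eq_vecI) auto
  moreover have "vmul v A + (-1) \<cdot>\<^sub>v vmul w A = vmul v A - vmul w A"
    using vmul_carrier[OF A, of v] vmul_carrier[OF A, of w] by (intro eq_vecI) auto
  ultimately show ?thesis using assms by (simp add: vmul_add_vec[OF A] vmul_smult_vec[OF A])
qed

lemma inj_on_vmul_iff: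
  fixes A :: "'a :: comm_ring_1 mat"
  assumes A: "A \<in> carrier_mat m n"
  shows "inj_on (\<lambda>y. vmul y A) (carrier_vec m) \<longleftrightarrow>
    (\<forall>y \<in> carrier_vec m. vmul y A = 0\<^sub>v n \<longrightarrow> y = 0\<^sub>v m)"
proof
  assume inj: "inj_on (\<lambda>y. vmul y A) (carrier_vec m)"
  then show "\<forall>y \<in> carrier_vec m. vmul y A = 0\<^sub>v n \<longrightarrow> y = 0\<^sub>v m"
    using vmul_zero_vec[OF A] by (auto dest: inj_onD[of _ _ _ "0\<^sub>v m"])
next
  assume ker: "\<forall>y \<in> carrier_vec m. vmul y A = 0\<^sub>v n \<longrightarrow> y = 0\<^sub>v m"
  show "inj_on (\<lambda>y. vmul y A) (carrier_vec m)"
  proof (rule inj_onI)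
    fix y z assume yz: "y \<in> carrier_vec m" "z \<in> carrier_vec m" "vmul y A = vmul z A"
    then have "vmul (y - z) A = 0\<^sub>v n"
      using vmul_diff_vec[OF A yz(1,2)] vmul_carrier[OF A, of z] by simp
    then have d: "y - z = 0\<^sub>v m" using ker yz by simp
    have "y $ i = z $ i" if "i < m" for i
      using arg_cong[OF d, of "\<lambda>v. vec_index v i"] that yz by simp
    then show "y = z" using yz by (intro eq_vecI) auto
  qed
qed

text \<open>The rows of \<open>R\<close> are a basis of \<open>W\<close>. Take the largest
  \<open>D\<close> that admits an injective coordinate map into \<open>W\<close>; counting gives
  \<open>D\<close> <= \<open>n\<close>. If the map missed some \<open>w\<close> in \<open>W\<close>,
  the row \<open>w\<close> could be adjoined to \<open>R\<close> and injectivity would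
  persist.\<close>

lemma subspace_basis:
  fixes W :: "'a :: {finite, field} vec set"
  assumes W: "W \<subseteq> carrier_vec n" "0\<^sub>v n \<in> W"
    and add: "\<And>v w. v \<in> W \<Longrightarrow> w \<in> W \<Longrightarrow> v + w \<in> W"
    and smult: "\<And>c w. w \<in> W \<Longrightarrow> c \<cdot>\<^sub>v w \<in> W"
  obtains D R where "R \<in> carrier_mat D n" "bij_betw (\<lambda>y. vmul y R) (carrier_vec D) W"
proof -
  let ?Q = "\<lambda>D. \<exists>R \<in> carrier_mat D n. inj_on (\<lambda>y. vmul y R) (carrier_vec D) \<and>
      (\<lambda>y. vmul y R) ` carrier_vec D \<subseteq> W"
  have "?Q 0"
  proof (intro bexI conjI)
    show Z: "0\<^sub>m 0 n \<in> carrier_mat 0 n" by simp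
    have "v = 0\<^sub>v 0" if "v \<in> carrier_vec 0" for v :: "'a vec" using that by (intro eq_vecI) auto
    then show "inj_on (\<lambda>y. vmul y (0\<^sub>m 0 n :: 'a mat)) (carrier_vec 0)"
      "(\<lambda>y. vmul y (0\<^sub>m 0 n :: 'a mat)) ` carrier_vec 0 \<subseteq> W"
      using vmul_zero_vec[OF Z] W(2) by (metis inj_onI, metis image_subsetI)
  qed
  moreover have bound: "D \<le> n" if Q: "?Q D" for D
  proof -
    from Q have "card (carrier_vec D :: 'a vec set) \<le> card (carrier_vec n :: 'a vec set)"
      using W finite_carrier_vec by (metis card_inj_on_le order_trans)
    then show ?thesis
      unfolding card_carrier_vec using CARD_field_gt_1[where 'a = 'a] power_increasing_iff by blast
  qed
  ultimately obtain D where D: "?Q D" and max: "\<And>D'. ?Q D' \<Longrightarrow> D' \<le> D"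
    using ex_has_greatest_nat[of ?Q 0 "\<lambda>D. D" "Suc n"] by (metis less_Suc_eq_le)
  then obtain R where R: "R \<in> carrier_mat D n" and inj: "inj_on (\<lambda>y. vmul y R) (carrier_vec D)"
    and im: "(\<lambda>y. vmul y R) ` carrier_vec D \<subseteq> W" by blast
  have "W \<subseteq> (\<lambda>y. vmul y R) ` carrier_vec D"
  proof (rule ccontr)
    assume "\<not> ?thesis"
    then obtain w where w: "w \<in> W" "w \<notin> (\<lambda>y. vmul y R) ` carrier_vec D" by blast
    then have wn: "w \<in> carrier_vec n" using W by blast
    let ?w = "mat_of_row w"
    have M: "?w \<in> carrier_mat 1 n" using wn by auto
    have z: "vmul z ?w = z $ 0 \<cdot>\<^sub>v w" if "z \<in> carrier_vec 1" for z
    proof (rule eq_vecI)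
      show "dim_vec (vmul z ?w) = dim_vec (z $ 0 \<cdot>\<^sub>v w)"
        using vmul_carrier[OF M, of z] wn by simp
      fix j assume "j < dim_vec (z $ 0 \<cdot>\<^sub>v w)"
      then have "j < n" using wn by simp
      then show "vmul z ?w $ j = (z $ 0 \<cdot>\<^sub>v w) $ j"
        using index_vmul[OF M] that wn by (simp add: scalar_prod_def)
    qed
    have split: "\<exists>y1 \<in> carrier_vec D. \<exists>z1 \<in> carrier_vec 1. y = y1 @\<^sub>v z1 \<and>
        vmul y (R @\<^sub>r ?w) = vmul y1 R + z1 $ 0 \<cdot>\<^sub>v w" if y: "y \<in> carrier_vec (D + 1)" for y
      using vmul_append_rows[OF R M] z vec_first_last_append[OF y]
      by (metis vec_first_carrier vec_last_carrier)
    have "?Q (D + 1)"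
    proof (intro bexI conjI)
      show RM: "R @\<^sub>r ?w \<in> carrier_mat (D + 1) n" using R M by (rule carrier_append_rows)
      show "(\<lambda>y. vmul y (R @\<^sub>r ?w)) ` carrier_vec (D + 1) \<subseteq> W"
      proof
        fix u assume "u \<in> (\<lambda>y. vmul y (R @\<^sub>r ?w)) ` carrier_vec (D + 1)"
        then obtain y1 z1 :: "'a vec" where "y1 \<in> carrier_vec D" "u = vmul y1 R + z1 $ 0 \<cdot>\<^sub>v w"
          using split by blast
        then show "u \<in> W" using im add smult[OF w(1)] by blast
      qed
      show "inj_on (\<lambda>y. vmul y (R @\<^sub>r ?w)) (carrier_vec (D + 1))"
        unfolding inj_on_vmul_iff[OF RM]
      proof (intro ballI impI)
        fix y assume y: "y \<in> carrier_vec (D + 1)" "vmul y (R @\<^sub>r ?w) = 0\<^sub>v n"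
        then obtain y1 z1 :: "'a vec" where 1: "y1 \<in> carrier_vec D" "z1 \<in> carrier_vec 1" "y = y1 @\<^sub>v z1"
          "vmul y1 R + z1 $ 0 \<cdot>\<^sub>v w = 0\<^sub>v n" using split[OF y(1)] by force
        have y1R: "vmul y1 R \<in> carrier_vec n" using R by simp
        have eq: "vmul y1 R $ j + z1 $ 0 * w $ j = 0" if "j < n" for j
          using arg_cong[OF 1(4), of "\<lambda>v. vec_index v j"] that wn by simp
        have z0: "z1 $ 0 = 0"
        proof (rule ccontr)
          assume c: "z1 $ 0 \<noteq> 0"
          \<comment> \<open>If \<open>w\<close> had a nonzero coefficient, solving the relation for
            \<open>w\<close> would put it into the row space of \<open>R\<close>.\<close>
          let ?y = "(- inverse (z1 $ 0)) \<cdot>\<^sub>v y1"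
          have "vmul ?y R = w"
          proof (rule eq_vecI)
            fix j assume "j < dim_vec w"
            then have j: "j < n" using wn by simp
            have "vmul ?y R $ j = - inverse (z1 $ 0) * vmul y1 R $ j"
              using vmul_smult_vec[OF R 1(1)] y1R j by simp
            also have "vmul y1 R $ j = - (z1 $ 0 * w $ j)" using eq[OF j] by (simp add: eq_neg_iff_add_eq_0)
            finally show "vmul ?y R $ j = w $ j" using c by simp
          qed (use vmul_carrier[OF R, of ?y] wn in simp)
          then show False using w(2) 1(1) by (metis imageI smult_carrier_vec)
        qed
        then have "vmul y1 R = 0\<^sub>v n" using eq y1R by (intro eq_vecI) auto
        then have "y1 = 0\<^sub>v D" using inj 1(1) inj_on_vmul_iff[OF R] by blast
        then show "y = 0\<^sub>v (D + 1)" using z0 1 by (intro eq_vecI) auto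
      qed
    qed
    then show False using max by force
  qed
  then have "bij_betw (\<lambda>y. vmul y R) (carrier_vec D) W"
    unfolding bij_betw_def using inj im by blast
  then show thesis using R that by blast
qed

section \<open>Kernels of coprime factors of the characteristic polynomial\<close>

text \<open>\<open>A\<close> is the matrix of \<open>X\<close> on the row space of \<open>R\<close>:
  its row i holds coordinates of the image of row i of \<open>R\<close> under
  \<open>X\<close>.\<close>

lemma restriction_matrix:
  fixes X :: "'a :: comm_ring_1 mat"
  assumes R: "R \<in> carrier_mat m n" and X: "X \<in> carrier_mat n n"
    and inv: "\<And>y. y \<in> carrier_vec m \<Longrightarrow> vmul (vmul y R) X \<in> (\<lambda>y. vmul y R) ` carrier_vec m"
  obtains A where "A \<in> carrier_mat m m" "R * X = A * R"
proof -
  have "\<forall>i. \<exists>a. i < m \<longrightarrow> a \<in> carrier_vec m \<and> vmul (vmul (unit_vec m i) R) X = vmul a R"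
    using inv by (metis image_iff unit_vec_carrier)
  then obtain a where a: "\<And>i. i < m \<Longrightarrow> a i \<in> carrier_vec m \<and> vmul (vmul (unit_vec m i) R) X = vmul (a i) R"
    by metis
  define A where "A = mat\<^sub>r m m a"
  have A: "A \<in> carrier_mat m m" unfolding A_def by simp
  have "R * X = A * R"
  proof (rule eq_rowI)
    fix i assume "i < dim_row (A * R)"
    then have i: "i < m" using A by simp
    have RX: "R * X \<in> carrier_mat m n" and AR: "A * R \<in> carrier_mat m n" using R X A by auto
    have "row (R * X) i = vmul (a i) R"
      using a[OF i] vmul_unit_vec[OF RX i] vmul_assoc[OF R X, of "unit_vec m i"] i by simp
    also have "a i = vmul (unit_vec m i) A"
      using vmul_unit_vec[OF A i] a[OF i] i by (simp add: A_def)
    also have "vmul \<dots> R = row (A * R) i"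
      using vmul_unit_vec[OF AR i] vmul_assoc[OF A R, of "unit_vec m i"] i by simp
    finally show "row (R * X) i = row (A * R) i" .
  qed (use R X A in auto)
  then show thesis using A that by blast
qed

text \<open>\<open>R\<close> intertwines \<open>A\<close> with \<open>X\<close>, hence also every
  polynomial in them. Annihilators of the subspace can thus be carried over to
  \<open>A\<close>.\<close>

lemma vact_restriction:
  fixes X :: "'a :: comm_ring_1 mat"
  assumes R: "R \<in> carrier_mat m n" and X: "X \<in> carrier_mat n n"
    and A: "A \<in> carrier_mat m m" and eq: "R * X = A * R" and y: "y \<in> carrier_vec m"
  shows "vmul (vact m y p A) R = vact n (vmul y R) p X"
  using y
proof (induction p arbitrary: y)
  case 0
  then show ?case using R by simp
next
  case (pCons c p)
  have "vmul (vmul y A) R = vmul (vmul y R) X"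
    using vmul_assoc[OF A R pCons.prems] vmul_assoc[OF R X pCons.prems] eq by simp
  then show ?case
    using pCons A X R by (simp add: vact_pCons vmul_add_vec[of _ m n] vmul_smult_vec[of _ m n])
qed

lemma char_poly_block_diag:
  fixes A B :: "'a :: idom mat"
  assumes A: "A \<in> carrier_mat m m" and B: "B \<in> carrier_mat k k"
  shows "char_poly (four_block_mat A (0\<^sub>m m k) (0\<^sub>m k m) B) = char_poly A * char_poly B"
proof -
  let ?N = "four_block_mat A (0\<^sub>m m k) (0\<^sub>m k m) B"
  have "char_poly_matrix ?N =
      four_block_mat (char_poly_matrix A) (0\<^sub>m m k) (0\<^sub>m k m) (char_poly_matrix B)"
    using A B unfolding char_poly_matrix_def by (intro eq_matI) auto
  then show ?thesis
    using A B unfolding char_poly_def by (simp add: det_four_block_mat_upper_right_zero[of _ m])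
qed

text \<open>The two kernels give a block diagonalisation of \<open>X\<close>.  The block belonging to \<open>ker p(X)\<close> has
  size \<open>dim (ker p(X))\<close>, and its characteristic polynomial divides a power of \<open>p\<close>, hence is coprime
  to \<open>r\<close> and divides \<open>p\<close>; comparing degrees gives equality.\<close>
lemma card_kernel_coprime_factor:
  fixes X :: "'a :: {finite, field_gcd} mat"
  assumes X: "X \<in> carrier_mat n n" and pr: "char_poly X = p * r" and cop: "coprime p r"
  shows "card {w \<in> carrier_vec n. vact n w p X = 0\<^sub>v n} = CARD('a) ^ degree p"
proof -
  define W where "W = (\<lambda>f. {w \<in> carrier_vec n. vact n w f X = 0\<^sub>v n})"
  have basis: "\<exists>D R. R \<in> carrier_mat D n \<and> bij_betw (\<lambda>y. vmul y R) (carrier_vec D) (W f)" for f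
    by (rule subspace_basis[of "W f" n])
      (use X in \<open>auto simp: W_def vact_add_vec vact_smult_vec\<close>)
  obtain D1 R1 where R1: "R1 \<in> carrier_mat D1 n" and b1: "bij_betw (\<lambda>y. vmul y R1) (carrier_vec D1) (W p)"
    using basis by blast
  obtain D2 R2 where R2: "R2 \<in> carrier_mat D2 n" and b2: "bij_betw (\<lambda>y. vmul y R2) (carrier_vec D2) (W r)"
    using basis by blast
  define P where "P = R1 @\<^sub>r R2"
  have P': "P \<in> carrier_mat (D1 + D2) n" unfolding P_def using R1 R2 by (rule carrier_append_rows)
  obtain s t where st: "s * p + t * r = 1"
    using cop bezout_coefficients_fst_snd[of p r] by (metis coprime_imp_gcd_eq_1)
  \<comment> \<open>The Bezout summands act as projections: t r maps into ker p(X) and s p into ker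
    r(X), because p r = c_X annihilates everything.\<close>
  have dec: "w = vact n w (t * r) X + vact n w (s * p) X" if "w \<in> carrier_vec n" for w
    using vact_add_poly[OF X that, of "t * r" "s * p"] vact_1[OF X that] st by (simp add: add.commute)
  have W_cap: "w = 0\<^sub>v n" if "w \<in> W p" "w \<in> W r" for w
  proof -
    have "vact n w (t * r) X = 0\<^sub>v n" "vact n w (s * p) X = 0\<^sub>v n"
      using that X unfolding W_def by (simp_all add: mult.commute[of _ p] mult.commute[of _ r] vact_mult)
    then show ?thesis using dec[of w] that unfolding W_def by auto
  qed
  have inj: "inj_on (\<lambda>y. vmul y P) (carrier_vec (D1 + D2))"
    unfolding inj_on_vmul_iff[OF P']
  proof (intro ballI impI)
    fix y assume y: "y \<in> carrier_vec (D1 + D2)" and y0: "vmul y P = 0\<^sub>v n"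
    define y1 y2 where "y1 = vec_first y D1" and "y2 = vec_last y D2"
    have y12: "y1 \<in> carrier_vec D1" "y2 \<in> carrier_vec D2" "y = y1 @\<^sub>v y2"
      unfolding y1_def y2_def using vec_first_last_append[OF y] by auto
    have W1: "vmul y1 R1 \<in> W p" and W2: "vmul y2 R2 \<in> W r"
      using b1 b2 y12 unfolding bij_betw_def by blast+
    have sum: "vmul y1 R1 + vmul y2 R2 = 0\<^sub>v n"
      using vmul_append_rows[OF R1 R2 y12(1,2)] y0 y12(3) unfolding P_def by simp
    have "vmul y1 R1 = (-1) \<cdot>\<^sub>v vmul y2 R2"
    proof (rule eq_vecI)
      fix j assume "j < dim_vec ((-1) \<cdot>\<^sub>v vmul y2 R2)"
      then have j: "j < n" using vmul_carrier[OF R2, of y2] by simp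
      show "vec_index (vmul y1 R1) j = vec_index ((-1) \<cdot>\<^sub>v vmul y2 R2) j"
        using arg_cong[OF sum, of "\<lambda>v. vec_index v j"] j vmul_carrier[OF R2, of y2]
        by (simp add: eq_neg_iff_add_eq_0)
    qed (use vmul_carrier[OF R1, of y1] vmul_carrier[OF R2, of y2] in simp)
    moreover have "(-1) \<cdot>\<^sub>v vmul y2 R2 \<in> W r"
      using W2 X unfolding W_def by (auto simp: vact_smult_vec)
    ultimately have z1: "vmul y1 R1 = 0\<^sub>v n" using W1 W_cap by simp
    then have z2: "vmul y2 R2 = 0\<^sub>v n" using sum vmul_carrier[OF R2, of y2] by simp
    have "y1 = 0\<^sub>v D1" "y2 = 0\<^sub>v D2"
      using b1 b2 z1 z2 y12 inj_on_vmul_iff[OF R1] inj_on_vmul_iff[OF R2]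
      unfolding bij_betw_def by blast+
    then show "y = 0\<^sub>v (D1 + D2)" using y12(3) by (intro eq_vecI) auto
  qed
  have "(\<lambda>y. vmul y P) ` carrier_vec (D1 + D2) = carrier_vec n"
  proof
    show "(\<lambda>y. vmul y P) ` carrier_vec (D1 + D2) \<subseteq> carrier_vec n" using P' by auto
    show "carrier_vec n \<subseteq> (\<lambda>y. vmul y P) ` carrier_vec (D1 + D2)"
    proof
      fix w :: "'a vec" assume w: "w \<in> carrier_vec n"
      have 0: "vact n w (p * r * f) X = 0\<^sub>v n" for f
        using vact_mult[OF X w, of "char_poly X" f] vact_char_poly[OF X w] X pr by simp
      have "vact n w (t * r) X \<in> W p" "vact n w (s * p) X \<in> W r"
        using 0[of t] 0[of s] X w unfolding W_def
        by (simp_all add: vact_mult[symmetric] mult_ac)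
      then obtain y1 y2 where y: "y1 \<in> carrier_vec D1" "vact n w (t * r) X = vmul y1 R1"
        "y2 \<in> carrier_vec D2" "vact n w (s * p) X = vmul y2 R2"
        using bij_betw_imp_surj_on[OF b1, symmetric] bij_betw_imp_surj_on[OF b2, symmetric] by auto
      then have "w = vmul (y1 @\<^sub>v y2) P"
        using dec[OF w] vmul_append_rows[OF R1 R2] unfolding P_def by simp
      then show "w \<in> (\<lambda>y. vmul y P) ` carrier_vec (D1 + D2)" using y by blast
    qed
  qed
  then have "bij_betw (\<lambda>y. vmul y P) (carrier_vec (D1 + D2)) (carrier_vec n)"
    using inj unfolding bij_betw_def by blast
  \<comment> \<open>The bijection gives q ^ (D1 + D2) = q ^ n; this makes \<open>P\<close> square,
    so that it can be inverted.\<close>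
  then have D: "D1 + D2 = n"
    using bij_betw_same_card[of _ "carrier_vec (D1 + D2)" "carrier_vec n :: 'a vec set"]
      CARD_field_gt_1[where 'a = 'a] power_inject_exp by (metis card_carrier_vec)
  have P: "P \<in> carrier_mat n n" using P' D by simp
  have "det (transpose_mat P) \<noteq> 0"
    using inj_on_vmul_iff[OF P] inj D P
    by (subst det_0_iff_vec_prod_zero[of _ n]) (auto simp: vmul_def)
  then have "det P \<noteq> 0" using det_transpose[OF P] by simp
  from det_non_zero_imp_unit[OF P this, of n]
  obtain Q where Q: "Q \<in> carrier_mat n n" "Q * P = 1\<^sub>m n" "P * Q = 1\<^sub>m n"
    unfolding Units_def ring_mat_def by auto
  have stable: "vmul (vmul y R) X \<in> (\<lambda>y. vmul y R) ` carrier_vec m"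
    if "R \<in> carrier_mat m n" "bij_betw (\<lambda>y. vmul y R) (carrier_vec m) (W f)" "y \<in> carrier_vec m" for R m f y
  proof -
    have "vmul y R \<in> W f" and im: "(\<lambda>y. vmul y R) ` carrier_vec m = W f"
      using that unfolding bij_betw_def by blast+
    then have "vmul (vmul y R) X \<in> W f"
      unfolding W_def using X by (auto simp: vact_vmul)
    then show ?thesis using im by simp
  qed
  obtain A1 where A1: "A1 \<in> carrier_mat D1 D1" "R1 * X = A1 * R1"
    using restriction_matrix[OF R1 X] stable[OF R1 b1] by blast
  obtain A2 where A2: "A2 \<in> carrier_mat D2 D2" "R2 * X = A2 * R2"
    using restriction_matrix[OF R2 X] stable[OF R2 b2] by blast
  define N where "N = four_block_mat A1 (0\<^sub>m D1 D2) (0\<^sub>m D2 D1) A2"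
  have N: "N \<in> carrier_mat n n" unfolding N_def D[symmetric] using A1 A2 by (intro four_block_carrier_mat)
  have "P * X = N * P"
  proof (rule eq_mat_vmulI[where m = n and n = n])
    fix y :: "'a vec" assume y: "y \<in> carrier_vec n"
    define y1 y2 where "y1 = vec_first y D1" and "y2 = vec_last y D2"
    have y12: "y1 \<in> carrier_vec D1" "y2 \<in> carrier_vec D2" "y = y1 @\<^sub>v y2"
      unfolding y1_def y2_def using vec_first_last_append[of y D1 D2] y D by auto
    have "vmul y N = vmul y1 A1 @\<^sub>v vmul y2 A2"
    proof -
      have "transpose_mat N = four_block_mat (transpose_mat A1) (0\<^sub>m D1 D2) (0\<^sub>m D2 D1) (transpose_mat A2)"
        unfolding N_def by (subst transpose_four_block_mat[of _ D1 D1 _ D2 _ D2]) (use A1 A2 in auto)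
      moreover have "0\<^sub>m D1 D2 *\<^sub>v y2 = 0\<^sub>v D1" "0\<^sub>m D2 D1 *\<^sub>v y1 = 0\<^sub>v D2"
        using y12 by (auto intro!: eq_vecI)
      moreover have "transpose_mat A1 *\<^sub>v y1 \<in> carrier_vec D1" "transpose_mat A2 *\<^sub>v y2 \<in> carrier_vec D2"
        using vmul_carrier[OF A1(1), of y1] vmul_carrier[OF A2(1), of y2] by (simp_all add: vmul_def)
      ultimately show ?thesis
        using four_block_mat_mult_vec[of "transpose_mat A1" D1 D1 "0\<^sub>m D1 D2" D2 "0\<^sub>m D2 D1" D2
            "transpose_mat A2" y1 y2] A1(1) A2(1) y12
        unfolding vmul_def by simp
    qed
    then have "vmul y (N * P) = vmul (vmul y1 A1) R1 + vmul (vmul y2 A2) R2"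
      using vmul_assoc[OF N P y] vmul_append_rows[OF R1 R2, of "vmul y1 A1" "vmul y2 A2"] A1 A2
      unfolding P_def by simp
    also have "\<dots> = vmul (vmul y1 R1) X + vmul (vmul y2 R2) X"
      using vmul_assoc[OF A1(1) R1 y12(1)] vmul_assoc[OF A2(1) R2 y12(2)]
        vmul_assoc[OF R1 X y12(1)] vmul_assoc[OF R2 X y12(2)] A1 A2 by simp
    also have "\<dots> = vmul (vmul y1 R1 + vmul y2 R2) X"
      using vmul_add_vec[OF X, of "vmul y1 R1" "vmul y2 R2"] R1 R2 by simp
    also have "\<dots> = vmul y (P * X)"
      using vmul_assoc[OF P X y] vmul_append_rows[OF R1 R2 y12(1,2)] y12(3) unfolding P_def by simp
    finally show "vmul y (P * X) = vmul y (N * P)" by simp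
  qed (use P X N in auto)
  then have "Q * P * X = Q * N * P"
    using assoc_mult_mat[OF Q(1) P X] assoc_mult_mat[OF Q(1) N P] by simp
  then have "X = Q * N * P" using Q(2) X by simp
  then have "similar_mat X N"
    using Q P X N by (intro similar_matI[of _ _ Q P n]) auto
  then have cA: "char_poly A1 * char_poly A2 = p * r"
    using char_poly_similar char_poly_block_diag[OF A1(1) A2(1)] pr unfolding N_def by metis
  \<comment> \<open>f(X) kills the row space of \<open>R\<close>, and \<open>R\<close> is injective
    on coordinates, so f(A) kills every coordinate vector.\<close>
  have ann: "poly_mat m f A = 0\<^sub>m m m"
    if R: "R \<in> carrier_mat m n" and b: "bij_betw (\<lambda>y. vmul y R) (carrier_vec m) (W f)"
      and A: "A \<in> carrier_mat m m" "R * X = A * R" for R m f A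
  proof (rule eq_mat_vmulI[where m = m and n = m])
    fix y :: "'a vec" assume y: "y \<in> carrier_vec m"
    have "vmul y R \<in> W f" using b y unfolding bij_betw_def by blast
    then have "vmul (vact m y f A) R = 0\<^sub>v n"
      using vact_restriction[OF R X A y] unfolding W_def by simp
    then have "vact m y f A = 0\<^sub>v m"
      using b inj_on_vmul_iff[OF R] A unfolding bij_betw_def by simp
    moreover have "vmul y (0\<^sub>m m m) = 0\<^sub>v m"
      unfolding vmul_def using y by (intro eq_vecI) auto
    ultimately show "vmul y (poly_mat m f A) = vmul y (0\<^sub>m m m)" unfolding vact_def by simp
  qed (use A in auto)
  have "char_poly A1 dvd p ^ D1" "char_poly A2 dvd r ^ D2"
    using char_poly_dvd_power_annihilator ann[OF R1 b1 A1] ann[OF R2 b2 A2] A1 A2 by blast+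
  then have "coprime (char_poly A1) r" "coprime (char_poly A2) p"
    using cop coprime_divisors[of "char_poly A1" "p ^ D1" r r] coprime_divisors[of "char_poly A2" "r ^ D2" p p]
    by (auto simp: coprime_commute)
  moreover have "char_poly A1 dvd p * r" "char_poly A2 dvd r * p"
    using cA by (metis dvd_triv_left, metis dvd_triv_right mult.commute)
  ultimately have "char_poly A1 dvd p" "char_poly A2 dvd r"
    by (auto simp: coprime_dvd_mult_left_iff)
  moreover have "p \<noteq> 0" "r \<noteq> 0" using pr monic_char_poly[OF X] by auto
  ultimately have "D1 \<le> degree p" "D2 \<le> degree r"
    using dvd_imp_degree_le degree_char_poly A1(1) A2(1) by metis+
  moreover have "degree p + degree r = n"
    using degree_char_poly[OF X] degree_mult_eq[OF \<open>p \<noteq> 0\<close> \<open>r \<noteq> 0\<close>] pr by simp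
  ultimately have "D1 = degree p" using D by simp
  then show ?thesis
    using bij_betw_same_card[OF b1] card_carrier_vec[where 'a = 'a] unfolding W_def by simp
qed

section \<open>Primary components\<close>

lemma monic_imp_normalize:
  fixes p :: "'a :: field_gcd poly"
  shows "monic p \<Longrightarrow> normalize p = p"
  by (simp add: normalize_poly_eq_map_poly)

lemma monic_normalize:
  fixes p :: "'a :: field_gcd poly"
  shows "p \<noteq> 0 \<Longrightarrow> monic (normalize p)"
  by (simp add: is_unit_unit_factor dvd_field_iff normalize_poly_eq_map_poly degree_map_poly coeff_map_poly)

text \<open>A gcd is fixed by \<open>normalize\<close>, so the gcds formed by the loop are the monic
  ones.\<close>

lemma monic_gcd:
  fixes p r :: "'a :: field_gcd poly"
  assumes "p \<noteq> 0"
  shows "monic (gcd p r)"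
  using monic_normalize[of "gcd p r"] assms by simp

text \<open>\<open>prime\<close> means a prime element fixed by \<open>normalize\<close>, and for
  nonzero polynomials this says monic. The equivalence opens the way to the calculus of
  \<open>multiplicity\<close>.\<close>

lemma monic_irred_iff_prime:
  fixes h :: "'a :: field_gcd poly"
  shows "monic_irred h \<longleftrightarrow> prime h"
proof
  assume "monic_irred h"
  then show "prime h"
    unfolding monic_irred_def prime_def
    by (auto intro: irreducible_imp_prime_elem monic_imp_normalize)
next
  assume h: "prime h"
  then have "h \<noteq> 0" "normalize h = h" by (auto simp: prime_def)
  then show "monic_irred h"
    unfolding monic_irred_def using monic_normalize[of h] h
    by (auto intro: prime_elem_imp_irreducible)
qed

lemma degree_prime_pos:
  fixes h :: "'a :: field_gcd poly"
  assumes "prime h"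
  shows "degree h > 0"
  using assms by (metis is_unit_iff_degree neq0_conv not_prime_0 not_prime_unit)

lemma monic_prime:
  fixes h :: "'a :: field_gcd poly"
  shows "prime h \<Longrightarrow> monic h"
  using monic_irred_iff_prime monic_irred_def by blast

lemma prime_coprime_decomposition:
  fixes h c :: "'a :: field_gcd poly"
  assumes h: "prime h" and c: "c \<noteq> 0"
  obtains b where "c = h ^ multiplicity h c * b" "\<And>k. coprime (h ^ k) b"
proof -
  obtain b where b: "c = h ^ multiplicity h c * b" "\<not> h dvd b"
    using multiplicity_decompose'[of c h] c h by (metis not_prime_unit)
  then have "coprime h b" using h by (simp add: prime_imp_coprime)
  then show thesis using b that by simp
qed

text \<open>This bound justifies the exponent \<open>n\<close> in \<open>prim\<close> and limits the
  number of rounds.\<close>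

lemma multiplicity_char_poly_le:
  fixes X :: "'a :: field_gcd mat"
  assumes X: "X \<in> carrier_mat n n" and h: "prime h"
  shows "multiplicity h (char_poly X) \<le> n"
proof -
  have c0: "char_poly X \<noteq> 0" using monic_char_poly[OF X] by auto
  have "degree (h ^ multiplicity h (char_poly X)) \<le> n"
    using dvd_imp_degree_le[OF multiplicity_dvd c0] degree_char_poly[OF X] by simp
  then have "multiplicity h (char_poly X) * degree h \<le> n"
    using h by (simp add: degree_power_eq mult.commute)
  then show ?thesis using degree_prime_pos[OF h] by (metis One_nat_def Suc_leI le_trans mult.right_neutral mult_le_mono2)
qed

text \<open>Orders divide c_X, whose h-part is h ^ nu(h), so a higher power of h annihilates nothing
  more. The exponent nu(h) is needed for counting, since it makes the power a factor of c_X coprime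
  to its cofactor.\<close>

lemma prim_eq_kernel:
  fixes X :: "'a :: field_gcd mat"
  assumes X: "X \<in> carrier_mat n n" and h: "prime h"
  shows "prim n X h = {w \<in> carrier_vec n. vact n w (h ^ multiplicity h (char_poly X)) X = 0\<^sub>v n}"
proof -
  have c0: "char_poly X \<noteq> 0" using monic_char_poly[OF X] by auto
  obtain b where b: "char_poly X = h ^ multiplicity h (char_poly X) * b" "\<And>k. coprime (h ^ k) b"
    using prime_coprime_decomposition[OF h c0] by blast
  have "ordX n X w dvd h ^ n \<longleftrightarrow> ordX n X w dvd h ^ multiplicity h (char_poly X)"
    if w: "w \<in> carrier_vec n" for w
  proof
    assume o: "ordX n X w dvd h ^ n"
    then have "coprime (ordX n X w) b" using coprime_divisors[OF _ dvd_refl b(2)] by blast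
    then show "ordX n X w dvd h ^ multiplicity h (char_poly X)"
      using ordX_dvd_char_poly[OF X w] b(1) by (metis coprime_dvd_mult_left_iff)
  next
    assume "ordX n X w dvd h ^ multiplicity h (char_poly X)"
    then show "ordX n X w dvd h ^ n"
      using multiplicity_char_poly_le[OF X h] by (meson dvd_trans le_imp_power_dvd)
  qed
  then show ?thesis unfolding prim_def using ordX_dvd_iff[OF X] by auto
qed

lemma card_prim:
  fixes X :: "'a :: {finite, field_gcd} mat"
  assumes X: "X \<in> carrier_mat n n" and h: "prime h"
  shows "card (prim n X h) = CARD('a) ^ (multiplicity h (char_poly X) * degree h)"
proof -
  have c0: "char_poly X \<noteq> 0" using monic_char_poly[OF X] by auto
  obtain b where b: "char_poly X = h ^ multiplicity h (char_poly X) * b" "\<And>k. coprime (h ^ k) b"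
    using prime_coprime_decomposition[OF h c0] by blast
  then show ?thesis
    using card_kernel_coprime_factor[OF X b(1) b(2)] h
    by (simp add: prim_eq_kernel[OF X h] degree_power_eq mult.commute)
qed

lemma cyc_vact_subset:
  assumes X: "X \<in> carrier_mat n n" and w: "w \<in> carrier_vec n"
  shows "cyc n X (vact n w g X) \<subseteq> cyc n X w"
  unfolding cyc_def using vact_mult[OF X w, symmetric] by auto

text \<open>Acting by the h-free part \<open>g\<close> of the order leaves a vector of order h ^
  nu(h). Its cyclic space lies in V(h) and has the same number of elements.\<close>

lemma multiplicity_eq_imp_prim_cyclic:
  fixes X :: "'a :: {finite, field_gcd} mat"
  assumes X: "X \<in> carrier_mat n n" and w: "w \<in> carrier_vec n" and h: "prime h"
    and m: "multiplicity h (ordX n X w) = multiplicity h (char_poly X)"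
  obtains g where "vact n w g X \<in> prim n X h" "prim n X h = cyc n X (vact n w g X)"
proof -
  let ?k = "multiplicity h (char_poly X)"
  have o: "monic (ordX n X w)" using monic_ordX[OF X w] .
  then have "ordX n X w \<noteq> 0" by auto
  then obtain g where g: "ordX n X w = g * h ^ ?k"
    using prime_coprime_decomposition[OF h, of "ordX n X w"] m by (metis mult.commute)
  have mh: "monic (h ^ ?k)" using monic_prime[OF h] by (simp add: monic_power)
  have "monic g" using o mh unfolding g by (simp add: lead_coeff_mult)
  then have og: "ordX n X (vact n w g X) = h ^ ?k" using ordX_vact[OF X w g] by simp
  let ?u = "vact n w g X"
  have u: "?u \<in> carrier_vec n" using X by simp
  have "vact n ?u (p * h ^ ?k) X = 0\<^sub>v n" for p
    using og ordX_dvd_iff[OF X u] by (metis dvd_triv_right)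
  then have sub: "cyc n X ?u \<subseteq> prim n X h"
    using X vact_mult[OF X u] unfolding prim_eq_kernel[OF X h] cyc_def by auto
  moreover have "card (cyc n X ?u) = card (prim n X h)"
    using card_cyc[OF X u] card_prim[OF X h] og h by (simp add: degree_power_eq mult.commute)
  moreover have "finite (prim n X h)"
    unfolding prim_def by (rule finite_subset[OF _ finite_carrier_vec[of n]]) auto
  ultimately have "prim n X h = cyc n X ?u" using card_subset_eq by blast
  moreover have "?u \<in> cyc n X ?u" unfolding cyc_def using vact_1[OF X u] by (metis (mono_tags, lifting) mem_Collect_eq)
  ultimately show thesis using that by blast
qed

text \<open>For the direction that needs work, the h-free part \<open>b\<close> of ord(v) is
  removed: V(h) already lies in the cyclic space of a vector of order h ^ al(h), and counting gives
  nu(h) <= al(h).\<close>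

lemma prim_subset_cyc_iff:
  fixes X :: "'a :: {finite, field_gcd} mat"
  assumes X: "X \<in> carrier_mat n n" and v: "v \<in> carrier_vec n" and h: "prime h"
  shows "prim n X h \<subseteq> cyc n X v \<longleftrightarrow> multiplicity h (ordX n X v) = multiplicity h (char_poly X)"
proof
  assume "multiplicity h (ordX n X v) = multiplicity h (char_poly X)"
  then show "prim n X h \<subseteq> cyc n X v"
    using multiplicity_eq_imp_prim_cyclic[OF X v h] cyc_vact_subset[OF X v] by metis
next
  assume sub: "prim n X h \<subseteq> cyc n X v"
  let ?k = "multiplicity h (ordX n X v)" and ?c = "multiplicity h (char_poly X)"
  have o: "monic (ordX n X v)" using monic_ordX[OF X v] .
  then have "ordX n X v \<noteq> 0" by auto
  then obtain b where b: "ordX n X v = h ^ ?k * b" "\<And>k. coprime (h ^ k) b"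
    using prime_coprime_decomposition[OF h] by blast
  have "monic (h ^ ?k)" using monic_prime[OF h] by (simp add: monic_power)
  then have "monic b" using o by (subst (asm) (1 2) b(1)) (simp add: lead_coeff_mult)
  let ?u = "vact n v b X"
  have u: "?u \<in> carrier_vec n" using X by simp
  have ou: "ordX n X ?u = h ^ ?k" using ordX_vact[OF X v, of b "h ^ ?k"] b(1) \<open>monic b\<close> by (simp add: mult.commute)
  have "prim n X h \<subseteq> cyc n X ?u"
  proof
    fix x assume x: "x \<in> prim n X h"
    then obtain p where p: "x = vact n v p X" using sub unfolding cyc_def by blast
    have "vact n v (p * h ^ ?c) X = 0\<^sub>v n"
      using x prim_eq_kernel[OF X h] p vact_mult[OF X v] by simp
    \<comment> \<open>Since \<open>b\<close> is coprime to \<open>h\<close>, it divides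
      \<open>p\<close> itself, so \<open>x\<close> lies in the smaller cyclic space of
      \<open>?u\<close>.\<close>
    then have "b dvd p * h ^ ?c" using ordX_dvd_iff[OF X v] b(1) by (metis dvd_mult_right)
    then have "b dvd p" using b(2)[of ?c] by (simp add: coprime_dvd_mult_left_iff coprime_commute)
    then obtain r where "p = b * r" by blast
    then show "x \<in> cyc n X ?u" unfolding cyc_def using p vact_mult[OF X v] by auto
  qed
  then have "card (prim n X h) \<le> card (cyc n X ?u)"
    using finite_subset[OF cyc_carrier[OF X] finite_carrier_vec] by (intro card_mono)
  then have "CARD('a) ^ (?c * degree h) \<le> CARD('a) ^ (?k * degree h)"
    using card_prim[OF X h] card_cyc[OF X u] ou h by (simp add: degree_power_eq mult.commute)
  then have "?c * degree h \<le> ?k * degree h"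
    using CARD_field_gt_1[where 'a = 'a] power_increasing_iff by blast
  then have "?c \<le> ?k" using degree_prime_pos[OF h] by simp
  moreover have "?k \<le> ?c"
    using dvd_imp_multiplicity_le[OF ordX_dvd_char_poly[OF X v]] monic_char_poly[OF X] by fastforce
  ultimately show "?k = ?c" by simp
qed

section \<open>Direct sums of primary components\<close>

lemma vact_coprime_eq_0:
  fixes X :: "'a :: field_gcd mat"
  assumes X: "X \<in> carrier_mat n n" and w: "w \<in> carrier_vec n" and "coprime p r"
    and "vact n w p X = 0\<^sub>v n" "vact n w r X = 0\<^sub>v n"
  shows "w = 0\<^sub>v n"
proof -
  have "is_unit (ordX n X w)"
    using assms(3-5) ordX_dvd_iff[OF X w] coprime_common_divisor by blast
  then have "ordX n X w = 1"
    using monic_imp_normalize[OF monic_ordX[OF X w]] is_unit_normalize by metis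
  then show ?thesis using ordX_eq_1_iff[OF X w] by simp
qed

lemma coprime_prime_power_prod:
  fixes h :: "'a :: field_gcd poly"
  assumes "prime h" "h \<notin> H" "\<forall>g\<in>H. prime g"
  shows "coprime (h ^ k) (\<Prod>g\<in>H. g ^ k)"
  using assms by (intro prod_coprime_right) (metis coprime_power_left_iff coprime_power_right_iff primes_coprime)

text \<open>A Bezout relation between h ^ n and the product over the other primes splits off a
  summand in V(h); the rest is killed by the smaller product.\<close>

lemma prim_decomposition:
  fixes X :: "'a :: field_gcd mat"
  assumes X: "X \<in> carrier_mat n n" and "finite H" "\<forall>h\<in>H. prime h"
    and "w \<in> carrier_vec n" "vact n w (\<Prod>h\<in>H. h ^ n) X = 0\<^sub>v n"
  shows "\<exists>f. (\<forall>h. f h \<in> prim n X h) \<and> w = finsum_vec TYPE('a) n f H"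
  using assms(2-)
proof (induction arbitrary: w)
  case empty
  then have "w = 0\<^sub>v n" using X by simp
  then show ?case using X by (intro exI[of _ "\<lambda>_. 0\<^sub>v n"]) (auto simp: prim_def finsum_vec_empty)
next
  case (insert h H)
  let ?P = "\<Prod>h\<in>H. h ^ n"
  have "coprime (h ^ n) ?P"
    by (rule coprime_prime_power_prod) (use insert.hyps insert.prems in auto)
  then obtain s t where st: "s * h ^ n + t * ?P = 1"
    using bezout_coefficients_fst_snd[of "h ^ n" ?P] by (metis coprime_imp_gcd_eq_1)
  let ?x = "vact n w (t * ?P) X" and ?y = "vact n w (s * h ^ n) X"
  have w: "w = ?x + ?y"
    using vact_add_poly[OF X insert.prems(2), of "t * ?P" "s * h ^ n"] st X insert.prems
    by (simp add: add.commute)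
  have 0: "vact n w (h ^ n * ?P * r) X = 0\<^sub>v n" for r
    using insert.hyps insert.prems(3) vact_mult[OF X insert.prems(2), of "h ^ n * ?P" r] X by simp
  have "?x \<in> prim n X h"
    using 0[of t] X insert.prems unfolding prim_def by (simp add: mult_ac flip: vact_mult)
  have "vact n ?y ?P X = 0\<^sub>v n"
    using 0[of s] X insert.prems by (simp add: mult_ac flip: vact_mult)
  then obtain f where f: "\<And>h. f h \<in> prim n X h" "?y = finsum_vec TYPE('a) n f H"
    using insert.IH[of ?y] insert.prems X by auto
  let ?f = "f(h := ?x)"
  have fc: "f \<in> H \<rightarrow> carrier_vec n" using f(1) unfolding prim_def by auto
  have "finsum_vec TYPE('a) n ?f (insert h H) = ?x + finsum_vec TYPE('a) n ?f H"
    using finsum_vec_insert[OF insert.hyps(1,2), of ?f n] fc X insert.hyps(2) by auto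
  also have "finsum_vec TYPE('a) n ?f H = finsum_vec TYPE('a) n f H"
    using insert.hyps fc
    by (intro eq_vecI) (auto simp: index_finsum_vec finsum_vec_closed[THEN carrier_vecD] intro!: sum.cong)
  finally have "w = finsum_vec TYPE('a) n ?f (insert h H)"
    by (simp only: f(2)[symmetric] w[symmetric])
  moreover have "\<forall>h'. ?f h' \<in> prim n X h'" using f(1) \<open>?x \<in> prim n X h\<close> by simp
  ultimately show ?case by blast
qed

lemma finsum_vec_prim:
  fixes X :: "'a :: field_gcd mat"
  assumes X: "X \<in> carrier_mat n n" and "finite H" "\<forall>h\<in>H. f h \<in> prim n X h"
  shows "finsum_vec TYPE('a) n f H \<in> carrier_vec n"
    and "vact n (finsum_vec TYPE('a) n f H) (\<Prod>h\<in>H. h ^ n) X = 0\<^sub>v n"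
proof -
  show c: "finsum_vec TYPE('a) n f H \<in> carrier_vec n"
    using assms by (intro finsum_vec_closed) (auto simp: prim_def)
  show "vact n (finsum_vec TYPE('a) n f H) (\<Prod>h\<in>H. h ^ n) X = 0\<^sub>v n"
    using assms(2,3)
  proof induction
    case empty
    then show ?case using X by (simp add: finsum_vec_empty)
  next
    case (insert h H)
    let ?P = "\<Prod>h\<in>H. h ^ n"
    have fc: "f \<in> H \<rightarrow> carrier_vec n" "f h \<in> carrier_vec n"
      using insert.prems unfolding prim_def by auto
    have s: "finsum_vec TYPE('a) n f H \<in> carrier_vec n" using finsum_vec_closed[OF fc(1)] .
    have "vact n (f h) (h ^ n * ?P) X = 0\<^sub>v n"
      using insert.prems X fc by (simp add: vact_mult prim_def)
    moreover have "vact n (finsum_vec TYPE('a) n f H) (?P * h ^ n) X = 0\<^sub>v n"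
      using insert s X by (simp add: vact_mult)
    ultimately show ?case
      using insert.hyps finsum_vec_insert[OF insert.hyps fc] fc s X
      by (simp add: vact_add_vec mult.commute)
  qed
qed

text \<open>If the sum is zero, the summand at \<open>h\<close> is the negative of the others, hence
  killed both by h ^ n and by a polynomial coprime to it.\<close>

lemma finsum_vec_prim_eq_0:
  fixes X :: "'a :: field_gcd mat"
  assumes X: "X \<in> carrier_mat n n" and "finite H" "\<forall>h\<in>H. prime h" "\<forall>h\<in>H. f h \<in> prim n X h"
    and "finsum_vec TYPE('a) n f H = 0\<^sub>v n"
  shows "\<forall>h\<in>H. f h = 0\<^sub>v n"
  using assms(2-)
proof induction
  case empty
  then show ?case by simp
next
  case (insert h H)
  let ?S = "finsum_vec TYPE('a) n f H"
  have fc: "f \<in> H \<rightarrow> carrier_vec n" "f h \<in> carrier_vec n"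
    using insert.prems unfolding prim_def by auto
  note S = finsum_vec_prim[OF X insert.hyps(1), of f]
  have S: "?S \<in> carrier_vec n" "vact n ?S (\<Prod>h\<in>H. h ^ n) X = 0\<^sub>v n"
    using S insert.prems by auto
  have sum: "f h + ?S = 0\<^sub>v n"
    using insert.prems(3) finsum_vec_insert[OF insert.hyps fc] by simp
  have "vact n (f h + ?S) (\<Prod>h\<in>H. h ^ n) X = 0\<^sub>v n" using sum X by simp
  then have "vact n (f h) (\<Prod>h\<in>H. h ^ n) X = 0\<^sub>v n"
    using S X fc by (simp add: vact_add_vec)
  moreover have "vact n (f h) (h ^ n) X = 0\<^sub>v n" using insert.prems unfolding prim_def by simp
  moreover have "coprime (h ^ n) (\<Prod>h\<in>H. h ^ n)"
    by (rule coprime_prime_power_prod) (use insert.hyps insert.prems in auto)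
  ultimately have "f h = 0\<^sub>v n" using vact_coprime_eq_0[OF X fc(2)] by blast
  moreover have "?S = 0\<^sub>v n" using sum S(1) calculation by simp
  ultimately show ?case using insert by simp
qed

lemma prim_sum_directI:
  fixes X :: "'a :: field_gcd mat"
  assumes X: "X \<in> carrier_mat n n" and a: "a \<noteq> 0"
  shows "prim_sum_direct n X a"
  unfolding prim_sum_direct_def monic_irred_iff_prime
  using finsum_vec_prim_eq_0[OF X finite_prime_divisors[OF a]] by blast

text \<open>The order of \<open>u\<close> divides the product of the h ^ n, because its exponents
  are at most \<open>n\<close>; so every element of the cyclic space decomposes. Conversely, full
  exponents put each V(h) inside the cyclic space.\<close>

lemma cyc_eq_prim_sum:
  fixes X :: "'a :: {finite, field_gcd} mat"
  assumes X: "X \<in> carrier_mat n n" and u: "u \<in> carrier_vec n"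
    and full: "\<And>h. prime h \<Longrightarrow> h dvd ordX n X u \<Longrightarrow>
      multiplicity h (ordX n X u) = multiplicity h (char_poly X)"
  shows "cyc n X u = prim_sum n X (ordX n X u)"
proof
  let ?a = "ordX n X u"
  let ?H = "{h. prime h \<and> h dvd ?a}"
  have a0: "?a \<noteq> 0" using monic_ordX[OF X u] by auto
  have fin: "finite ?H" using finite_prime_divisors[OF a0] .
  have dvd: "?a dvd (\<Prod>h\<in>?H. h ^ n)"
  proof (rule multiplicity_le_imp_dvd[OF a0])
    fix p :: "'a poly" assume p: "prime p"
    show "multiplicity p ?a \<le> multiplicity p (\<Prod>h\<in>?H. h ^ n)"
    proof (cases "p dvd ?a")
      case True
      have "p ^ n dvd (\<Prod>h\<in>?H. h ^ n)" using fin True p by (intro dvd_prodI) auto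
      moreover have "(\<Prod>h\<in>?H. h ^ n) \<noteq> 0" using fin by auto
      ultimately have "n \<le> multiplicity p (\<Prod>h\<in>?H. h ^ n)"
        using not_prime_unit p by (intro multiplicity_geI) blast+
      then show ?thesis using full[OF p True] multiplicity_char_poly_le[OF X p] by simp
    qed (simp add: not_dvd_imp_multiplicity_0)
  qed
  show "cyc n X u \<subseteq> prim_sum n X ?a"
  proof
    fix x assume "x \<in> cyc n X u"
    then obtain p where p: "x = vact n u p X" unfolding cyc_def by blast
    have x: "x \<in> carrier_vec n" using p X by simp
    have "vact n u (p * (\<Prod>h\<in>?H. h ^ n)) X = 0\<^sub>v n"
      using ordX_dvd_iff[OF X u] dvd by (meson dvd_mult)
    then have "vact n x (\<Prod>h\<in>?H. h ^ n) X = 0\<^sub>v n" using p vact_mult[OF X u] by simp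
    from prim_decomposition[OF X fin _ x this] show "x \<in> prim_sum n X ?a"
      unfolding prim_sum_def monic_irred_iff_prime by blast
  qed
  have cyc_add: "x + y \<in> cyc n X u" if "x \<in> cyc n X u" "y \<in> cyc n X u" for x y
    using that vact_add_poly[OF X u, symmetric] unfolding cyc_def by auto
  have sum: "finsum_vec TYPE('a) n f H \<in> cyc n X u" if "finite H" "\<forall>h\<in>H. f h \<in> cyc n X u"
    for H :: "'a poly set" and f
    using that
  proof induction
    case empty
    have "0\<^sub>v n \<in> cyc n X u" unfolding cyc_def using vact_0[OF u, of X] by (metis (mono_tags, lifting) mem_Collect_eq)
    then show ?case by (simp add: finsum_vec_empty)
  next
    case (insert h H)
    then show ?case
      using finsum_vec_insert[OF insert.hyps, of f n] cyc_carrier[OF X] cyc_add by fastforce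
  qed
  show "prim_sum n X ?a \<subseteq> cyc n X u"
  proof
    fix x assume "x \<in> prim_sum n X ?a"
    then obtain f where "x = finsum_vec TYPE('a) n f ?H" "\<forall>h\<in>?H. f h \<in> prim n X h"
      unfolding prim_sum_def monic_irred_iff_prime by blast
    then show "x \<in> cyc n X u"
      using sum[OF fin, of f] prim_subset_cyc_iff[OF X u] full by blast
  qed
qed

section \<open>The while loop\<close>

lemma monic_eqI:
  fixes p r :: "'a :: field_gcd poly"
  assumes "monic p" "monic r" "\<And>h. prime h \<Longrightarrow> multiplicity h p = multiplicity h r"
  shows "p = r"
proof -
  have "p \<noteq> 0" "r \<noteq> 0" using assms(1,2) by auto
  then have "normalize p = normalize r" using assms(3) by (rule multiplicity_eq_imp_eq)
  then show ?thesis using assms(1,2) monic_imp_normalize by metis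
qed

lemma monic_eq_1I:
  fixes p :: "'a :: field_gcd poly"
  assumes "monic p" "\<And>h. prime h \<Longrightarrow> multiplicity h p = 0"
  shows "p = 1"
  using monic_eqI[of p 1] assms by simp

lemma multiplicity_div:
  fixes h p r :: "'a :: field_gcd poly"
  assumes "prime h" "r dvd p" "p \<noteq> 0"
  shows "multiplicity h (p div r) = multiplicity h p - multiplicity h r"
proof -
  obtain s where s: "p = r * s" using assms(2) by blast
  then have "r \<noteq> 0" "s \<noteq> 0" using assms(3) by auto
  then show ?thesis using assms(1) s by (simp add: prime_elem_multiplicity_mult_distrib)
qed

lemma monic_div:
  fixes p r :: "'a :: field_gcd poly"
  assumes "monic p" "monic r" "r dvd p"
  shows "monic (p div r)"
  using assms by (auto elim!: dvdE simp: lead_coeff_mult)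

text \<open>One round seen at a single prime h: \<open>al\<close> is its exponent in ord(v),
  \<open>de\<close> the defect nu(h) - al(h), \<open>K\<close> the power 2 ^ (i - 1), and
  \<open>A\<close>, \<open>D\<close>, \<open>E\<close> are its exponents in a, d, e. Truncated
  subtraction models that h is used up. If \<open>A\<close> <= \<open>K * de\<close>, nothing of h
  remains; otherwise \<open>D\<close> is \<open>K * de\<close> and the new exponent is twice that,
  capped.\<close>

lemma exponent_step:
  fixes al de K :: nat
  assumes "1 \<le> K"
  defines "A \<equiv> al - (K - 1) * de"
  defines "D \<equiv> min A (K * de)"
  defines "E \<equiv> min (A - D) D"
  shows "A - D = al - (2 * K - 1) * de"
    and "E + min (A - D - E) E = min (A - D) (2 * K * de)"
proof -
  define x where "x = K * de"
  have x: "de \<le> x" "(K - 1) * de = x - de" "(2 * K - 1) * de = 2 * x - de" "2 * K * de = 2 * x"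
    using assms(1) unfolding x_def by (auto simp: diff_mult_distrib)
  have AD: "A = al - (x - de)" "D = min A x" unfolding A_def D_def x(2) x_def by simp_all
  show "A - D = al - (2 * K - 1) * de"
    unfolding x(3) AD using x(1) by arith
  show "E + min (A - D - E) E = min (A - D) (2 * K * de)"
  proof (cases "A \<le> x")
    case False
    then have "D = x" using AD(2) by simp
    then show ?thesis unfolding E_def x(4) by arith
  qed (simp add: E_def AD(2) min_def)
qed

text \<open>Invariant: with \<open>al\<close>, \<open>nu\<close> the exponents of \<open>h\<close> in \<open>ord(v)\<close> and \<open>c\<^sub>X\<close>, the defect \<open>nu - al\<close>
  doubles in each round, so that \<open>h\<close> has been removed from \<open>a\<close> as soon as \<open>2 ^ (i - 1) > n\<close>,
  unless \<open>al = nu\<close>, in which case its exponent in \<open>a\<close> never changes.\<close>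
lemma isf_loop_correct:
  fixes X :: "'a :: {finite, field_gcd} mat"
  assumes X: "X \<in> carrier_mat n n" and v: "v \<in> carrier_vec n"
    and bound: "n < 2 ^ (bound - 1)"
  defines "al \<equiv> \<lambda>h. multiplicity h (ordX n X v)" and "nu \<equiv> \<lambda>h. multiplicity h (char_poly X)"
  assumes "1 \<le> i" "i \<le> bound" "ordX n X v = g * a" "monic g" "monic a" "a \<noteq> 1" "monic d"
    and "\<And>h. prime h \<Longrightarrow> multiplicity h a = al h - (2 ^ (i - 1) - 1) * (nu h - al h)"
    and "\<And>h. prime h \<Longrightarrow> multiplicity h d = min (multiplicity h a) (2 ^ (i - 1) * (nu h - al h))"
  defines "res \<equiv> isf_loop n X v bound i g (vact n v g X) a d"
  shows "(\<exists>g' a'. fst res = RetTrue (vact n v g' X) a' \<and> ordX n X v = g' * a' \<and> monic g' \<and> a' \<noteq> 1 \<and>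
            (\<forall>h. prime h \<longrightarrow> multiplicity h a' = (if al h = nu h then nu h else 0)) \<or>
          fst res = RetFalse \<and> (\<forall>h. prime h \<and> h dvd char_poly X \<longrightarrow> al h < nu h))
      \<and> snd res \<le> bound + 1 - i"
  using assms(6-14) unfolding res_def
proof (induction "bound - i" arbitrary: i g a d rule: less_induct)
  case less
  note i = less.prems(1,2) and o = less.prems(3) and monic = less.prems(4,5,7) and a1 = less.prems(6)
    and ma = less.prems(8) and md = less.prems(9)
  define K :: nat where "K = 2 ^ (i - 1)"
  have K: "1 \<le> K" unfolding K_def by simp
  have c0: "char_poly X \<noteq> 0" using monic_char_poly[OF X] by auto
  have nz: "a \<noteq> 0" "d \<noteq> 0" using monic by auto
  have le: "al h \<le> nu h" "al h \<le> n" if "prime h" for h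
  proof -
    show "al h \<le> nu h"
      unfolding al_def nu_def by (rule dvd_imp_multiplicity_le[OF ordX_dvd_char_poly[OF X v] c0])
    then show "al h \<le> n" using multiplicity_char_poly_le[OF X that] unfolding nu_def by simp
  qed
  note unfold = isf_loop.simps[of n X v bound i g "vact n v g X" a d]
  consider "d = 1" | "d \<noteq> 1" "d = a" | "d \<noteq> 1" "d \<noteq> a" by blast
  then show ?case
  proof cases
    case 1
    \<comment> \<open>The exponent of h in \<open>d\<close> is a minimum with value 0; for a
      positive defect the second entry is positive, so h no longer occurs in
      \<open>a\<close>.\<close>
    have "multiplicity h a = (if al h = nu h then nu h else 0)" if h: "prime h" for h
    proof (cases "al h = nu h")
      case False
      then have "2 ^ (i - 1) * (nu h - al h) \<noteq> 0" using le[OF h] by simp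
      then show ?thesis using md[OF h] 1 False by (simp add: min_def split: if_splits)
    qed (use ma[OF h] in simp)
    then show ?thesis using 1 i o monic a1 by (subst (1 2 3) unfold) auto
  next
    case 2
    have "al h < nu h" if h: "prime h" "h dvd char_poly X" for h
    proof (rule ccontr)
      assume "\<not> al h < nu h"
      then have eq: "al h = nu h" using le[OF h(1)] by simp
      \<comment> \<open>A prime without defect occurs in \<open>a\<close> with its full exponent but
        not in \<open>d\<close>, contradicting \<open>d = a\<close>.\<close>
      then have "multiplicity h d = 0" "multiplicity h a = nu h" using ma[OF h(1)] md[OF h(1)] by auto
      moreover have "nu h > 0"
        using h c0 by (simp add: nu_def prime_multiplicity_gt_zero_iff)
      ultimately show False using 2 by simp
    qed
    then show ?thesis using 2 i by (subst (1 2 3) unfold) auto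
  next
    case 3
    \<comment> \<open>The loop condition never fails: in the round \<open>i = bound\<close> every
      prime with positive defect has left \<open>a\<close>, which forces
      \<open>d = 1\<close>.\<close>
    have ib: "i < bound"
    proof (rule ccontr)
      assume "\<not> i < bound"
      then have n: "n < 2 ^ (i - 1)" using i bound by simp
      have "d = 1"
      proof (rule monic_eq_1I[OF monic(3)])
        fix h :: "'a poly" assume h: "prime h"
        show "multiplicity h d = 0"
        proof (cases "nu h - al h")
          case (Suc m)
          have "al h \<le> 2 ^ (i - 1) - 1" using le[OF h] n by simp
          also have "\<dots> \<le> (2 ^ (i - 1) - 1) * (nu h - al h)" using Suc by simp
          finally show ?thesis using md[OF h] ma[OF h] by simp
        qed (use md[OF h] in simp)
      qed
      then show False using 3 by simp
    qed
    define a' where "a' = a div d"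
    define e where "e = gcd a' d"
    define d' where "d' = e * gcd (a' div e) e"
    have "d dvd a" using md by (intro multiplicity_le_imp_dvd[OF nz(2)]) simp
    then have a: "a = d * a'" unfolding a'_def by simp
    have a'0: "a' \<noteq> 0" using a nz by auto
    have ma': "monic a'" unfolding a'_def using monic \<open>d dvd a\<close> by (intro monic_div)
    have me: "monic e" unfolding e_def using a'0 by (rule monic_gcd)
    have e: "e \<noteq> 0" "e dvd a'" using me unfolding e_def by auto
    have qe: "a' div e \<noteq> 0" using e a'0 by (auto simp: dvd_div_eq_0_iff)
    have md': "monic d'" unfolding d'_def using me monic_gcd[OF qe] by (simp add: lead_coeff_mult)
    have exps: "multiplicity h a' = al h - (2 * K - 1) * (nu h - al h)"
      "multiplicity h d' = min (multiplicity h a') (2 * K * (nu h - al h))" if h: "prime h" for h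
    proof -
      have A: "multiplicity h a = al h - (K - 1) * (nu h - al h)"
        and D: "multiplicity h d = min (multiplicity h a) (K * (nu h - al h))"
        using ma[OF h] md[OF h] unfolding K_def by auto
      have A': "multiplicity h a' = multiplicity h a - multiplicity h d"
        unfolding a'_def by (rule multiplicity_div[OF h \<open>d dvd a\<close> nz(1)])
      have E: "multiplicity h e = min (multiplicity h a') (multiplicity h d)"
        unfolding e_def by (rule multiplicity_gcd[OF a'0 nz(2) h])
      have "gcd (a' div e) e \<noteq> 0" using e by simp
      then have "multiplicity h d' = multiplicity h e + multiplicity h (gcd (a' div e) e)"
        unfolding d'_def using h e by (intro prime_elem_multiplicity_mult_distrib) auto
      also have "multiplicity h (gcd (a' div e) e) = min (multiplicity h a' - multiplicity h e) (multiplicity h e)"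
        using multiplicity_gcd[OF qe e(1) h] multiplicity_div[OF h e(2) a'0] by simp
      finally have D': "multiplicity h d' =
        multiplicity h e + min (multiplicity h a' - multiplicity h e) (multiplicity h e)" .
      show "multiplicity h a' = al h - (2 * K - 1) * (nu h - al h)"
        unfolding A' D A by (rule exponent_step(1)[OF K])
      show "multiplicity h d' = min (multiplicity h a') (2 * K * (nu h - al h))"
        unfolding D' E A' D A by (rule exponent_step(2)[OF K])
    qed
    have K2: "2 ^ (i + 1 - 1) = 2 * K" using i unfolding K_def by (cases i) auto
    let ?r = "isf_loop n X v bound (i + 1) (g * d) (vact n v (g * d) X) a' d'"
    have step: "isf_loop n X v bound i g (vact n v g X) a d = (fst ?r, snd ?r + 1)"
      using 3 i by (subst unfold) (simp add: Let_def a'_def e_def d'_def)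
    have "(\<exists>g' a'. fst ?r = RetTrue (vact n v g' X) a' \<and> ordX n X v = g' * a' \<and> monic g' \<and> a' \<noteq> 1 \<and>
            (\<forall>h. prime h \<longrightarrow> multiplicity h a' = (if al h = nu h then nu h else 0)) \<or>
          fst ?r = RetFalse \<and> (\<forall>h. prime h \<and> h dvd char_poly X \<longrightarrow> al h < nu h))
      \<and> snd ?r \<le> bound + 1 - (i + 1)"
    proof (rule less.hyps)
      show "bound - (i + 1) < bound - i" using ib by simp
      show "ordX n X v = g * d * a'" using o a by (simp add: mult.assoc)
      show "monic (g * d)" using monic by (simp add: lead_coeff_mult)
      show "a' \<noteq> 1" using a 3 by auto
    qed (use ib ma' md' exps K2 in simp_all)
    then show ?thesis unfolding step using ib by auto
  qed
qed

text \<open>The last admissible round has seen \<open>isf_bound n - 1\<close> doublings, that is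
  floor(log2 n) + 1, the first integer above log2 n.\<close>

lemma less_power_isf_bound: "n < 2 ^ (isf_bound n - 1)"
proof (cases "n = 0")
  case False
  then have n: "real n > 0" by simp
  have "log 2 (real n) < real (nat \<lfloor>log 2 (real n)\<rfloor> + 1)" by linarith
  then have "real n < 2 powr real (nat \<lfloor>log 2 (real n)\<rfloor> + 1)" using n by (simp add: log_less_iff)
  also have "\<dots> = real (2 ^ (isf_bound n - 1))"
    by (subst powr_realpow) (simp_all add: isf_bound_def)
  finally show ?thesis by linarith
qed simp

theorem theorem7p1:
  fixes X :: "'a :: {finite, field_gcd} mat" and v :: "'a vec" and n :: nat
  assumes X: "X \<in> carrier_mat n n"
    and v: "v \<in> carrier_vec n" and v0: "v \<noteq> 0\<^sub>v n"
  defines "cX \<equiv> char_poly X"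
  shows
    "(fst (IsfWitness n X v cX) \<noteq> NoReturn \<and> snd (IsfWitness n X v cX) \<le> nat \<lfloor>log 2 (real n)\<rfloor> + 2)
     \<and> ((\<exists>u a. fst (IsfWitness n X v cX) = RetTrue u a) \<longleftrightarrow>
          (\<exists>a'. monic a' \<and> degree a' > 0 \<and> a' dvd cX \<and> witness n X a' v))
     \<and> (\<forall>u a. fst (IsfWitness n X v cX) = RetTrue u a \<longrightarrow>
          u \<noteq> 0\<^sub>v n \<and> a = ordX n X u \<and> degree a > 0 \<and> gcd a (cX div a) = 1 \<and>
          cyc n X u = prim_sum n X a \<and> prim_sum_direct n X a \<and>
          prim_sum n X a \<subseteq> cyc n X v \<and> witness n X a v)
     \<and> (fst (IsfWitness n X v cX) = RetFalse \<longleftrightarrow>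
          (\<forall>h. monic_irred h \<and> h dvd cX \<and> fcyclic n X h \<longrightarrow>
              multiplicity h (ordX n X v) < multiplicity h cX))
     \<and> (uncyclic n X \<longrightarrow> fst (IsfWitness n X v cX) = RetFalse)"
proof -
  let ?al = "\<lambda>h. multiplicity h (ordX n X v)" and ?nu = "\<lambda>h. multiplicity h cX"
  \<comment> \<open>By \<open>prim_subset_cyc_iff\<close> these are the primes dividing c_X whose
    V(h) lies in v F[X]. The procedure returns \<open>RetTrue\<close> exactly if there is
    one.\<close>
  let ?full = "\<lambda>h. prime h \<and> h dvd cX \<and> ?al h = ?nu h"
  define res where "res = IsfWitness n X v cX"
  have c: "monic cX" "cX \<noteq> 0" unfolding cX_def using monic_char_poly[OF X] by auto
  have o: "monic (ordX n X v)" "ordX n X v dvd cX"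
    unfolding cX_def using monic_ordX[OF X v] ordX_dvd_char_poly[OF X v] by auto
  have o0: "ordX n X v \<noteq> 0" using o by auto
  have le: "?al h \<le> ?nu h" if "prime h" for h
    using dvd_imp_multiplicity_le[OF o(2) c(2)] .
  let ?d = "gcd (ordX n X v) (cX div ordX n X v)"
  have q0: "cX div ordX n X v \<noteq> 0" using o c by (simp add: dvd_div_eq_0_iff)
  \<comment> \<open>This is the loop invariant for \<open>i = 1\<close>, where the power of 2 is
    1.\<close>
  have d: "multiplicity h ?d = min (?al h) (?nu h - ?al h)" if h: "prime h" for h
    using multiplicity_gcd[OF o0 q0 h] multiplicity_div[OF h o(2) c(2)] by simp
  have res_eq: "res = isf_loop n X v (isf_bound n) 1 1 (vact n v 1 X) (ordX n X v) ?d"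
    unfolding res_def IsfWitness_def Let_def using vact_1[OF X v] by simp
  have main: "(\<exists>g a. fst res = RetTrue (vact n v g X) a \<and> ordX n X v = g * a \<and> monic g \<and> a \<noteq> 1 \<and>
            (\<forall>h. prime h \<longrightarrow> multiplicity h a = (if ?al h = ?nu h then ?nu h else 0)) \<or>
          fst res = RetFalse \<and> (\<forall>h. prime h \<and> h dvd cX \<longrightarrow> ?al h < ?nu h))
      \<and> snd res \<le> isf_bound n + 1 - 1"
    unfolding res_eq cX_def
  proof (rule isf_loop_correct[OF X v less_power_isf_bound])
    show "ordX n X v \<noteq> 1" using v0 ordX_eq_1_iff[OF X v] by simp
    show "monic (gcd (ordX n X v) (char_poly X div ordX n X v))" using monic_gcd[OF o0] .
  qed (use o d in \<open>auto simp: isf_bound_def cX_def\<close>)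
  \<comment> \<open>The two extra facts at the end, that \<open>a\<close> is monic and divides c_X,
    allow the returned \<open>a\<close> to serve as the polynomial a' in (2).\<close>
  have true: "u \<noteq> 0\<^sub>v n \<and> a = ordX n X u \<and> degree a > 0 \<and> gcd a (cX div a) = 1 \<and>
          cyc n X u = prim_sum n X a \<and> prim_sum_direct n X a \<and>
          prim_sum n X a \<subseteq> cyc n X v \<and> witness n X a v \<and> a dvd cX \<and> monic a"
    if ret: "fst res = RetTrue u a" for u a
  proof -
    obtain g where g: "u = vact n v g X" "ordX n X v = g * a" "monic g" "a \<noteq> 1"
      and ma: "\<And>h. prime h \<Longrightarrow> multiplicity h a = (if ?al h = ?nu h then ?nu h else 0)"
      using main ret by auto
    have u: "u \<in> carrier_vec n" using g X by simp
    have a: "ordX n X u = a" using ordX_vact[OF X v g(2,3)] g(1) by simp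
    have mon: "monic a" using monic_ordX[OF X u] a by simp
    then have a0: "a \<noteq> 0" by auto
    have dvd: "a dvd cX" using ordX_dvd_char_poly[OF X u] a unfolding cX_def by simp
    have deg: "degree a > 0" using mon g(4) monic_degree_0 by blast
    have full: "multiplicity h a = ?nu h" "?al h = ?nu h" if "prime h" "h dvd a" for h
      using ma[OF that(1)] that prime_multiplicity_gt_zero_iff[of h a] a0
      by (auto split: if_splits)
    have qa0: "cX div a \<noteq> 0" using dvd c by (simp add: dvd_div_eq_0_iff)
    have "gcd a (cX div a) = 1"
    proof (rule monic_eq_1I)
      show "monic (gcd a (cX div a))" using monic_gcd[OF a0] .
      fix h :: "'a poly" assume h: "prime h"
      \<comment> \<open>The exponent of h in \<open>a\<close> is 0 or nu(h), so h is missing from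
        \<open>a\<close> or from the quotient.\<close>
      show "multiplicity h (gcd a (cX div a)) = 0"
        using multiplicity_gcd[OF a0 qa0 h] multiplicity_div[OF h dvd c(2)] ma[OF h]
        by (auto split: if_splits)
    qed
    moreover have "cyc n X u = prim_sum n X a"
      using cyc_eq_prim_sum[OF X u] full(1) unfolding a cX_def by blast
    moreover have "cyc n X u \<subseteq> cyc n X v" using cyc_vact_subset[OF X v] g(1) by simp
    moreover have "witness n X a v"
      unfolding witness_def monic_irred_iff_prime
      using prim_subset_cyc_iff[OF X v] full(2) unfolding cX_def by blast
    moreover have "u \<noteq> 0\<^sub>v n" using ordX_eq_1_iff[OF X u] a g(4) by simp
    ultimately show ?thesis using a deg prim_sum_directI[OF X a0] dvd mon by simp
  qed
  have false: "\<not> ?full h" if "fst res = RetFalse" for h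
    using main that by fastforce
  have full: "\<exists>u a. fst res = RetTrue u a" if "?full h" for h
    using main that false by auto
  have wit: "\<exists>h. ?full h" if a': "monic a'" "degree a' > 0" "a' dvd cX" "witness n X a' v" for a'
  proof -
    have "\<not> is_unit a'" "a' \<noteq> 0" using a'(1,2) by (auto simp: is_unit_iff_degree)
    then obtain h where h: "prime h" "h dvd a'" using prime_divisor_exists by blast
    then have "prim n X h \<subseteq> cyc n X v"
      using a'(4) unfolding witness_def monic_irred_iff_prime by blast
    then have "?full h" using prim_subset_cyc_iff[OF X v h(1)] h a'(3) unfolding cX_def by (meson dvd_trans)
    then show ?thesis by blast
  qed
  \<comment> \<open>Every prime that could prevent \<open>RetFalse\<close> is f-cyclic, so a
    hypothesis about the f-cyclic primes alone excludes \<open>RetTrue\<close>.\<close>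
  have fcyc: "fcyclic n X h" if "?full h" for h
    using that multiplicity_eq_imp_prim_cyclic[OF X v, of h] unfolding fcyclic_def cX_def by metis
  have false_iff: "fst res = RetFalse \<longleftrightarrow>
      (\<forall>h. monic_irred h \<and> h dvd cX \<and> fcyclic n X h \<longrightarrow> ?al h < ?nu h)"
  proof
    assume "fst res = RetFalse"
    then show "\<forall>h. monic_irred h \<and> h dvd cX \<and> fcyclic n X h \<longrightarrow> ?al h < ?nu h"
      using main monic_irred_iff_prime by auto
  next
    assume lt: "\<forall>h. monic_irred h \<and> h dvd cX \<and> fcyclic n X h \<longrightarrow> ?al h < ?nu h"
    show "fst res = RetFalse"
    proof (rule ccontr)
      assume "fst res \<noteq> RetFalse"
      then obtain u a where "fst res = RetTrue u a" using main by auto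
      from true[OF this] have "monic a" "degree a > 0" "a dvd cX" "witness n X a v" by auto
      from wit[OF this] obtain h where "?full h" by blast
      moreover from this have "?al h < ?nu h" using fcyc lt monic_irred_iff_prime by blast
      ultimately show False by simp
    qed
  qed
  have "(\<exists>u a. fst res = RetTrue u a) \<longleftrightarrow>
      (\<exists>a'. monic a' \<and> degree a' > 0 \<and> a' dvd cX \<and> witness n X a' v)"
    using true wit full by blast
  moreover have "uncyclic n X \<longrightarrow> fst res = RetFalse"
    using false_iff unfolding uncyclic_def cX_def by blast
  moreover have "fst res \<noteq> NoReturn" "snd res \<le> nat \<lfloor>log 2 (real n)\<rfloor> + 2"
    using main unfolding isf_bound_def by auto
  moreover have "\<forall>u a. fst res = RetTrue u a \<longrightarrow>
          u \<noteq> 0\<^sub>v n \<and> a = ordX n X u \<and> degree a > 0 \<and> gcd a (cX div a) = 1 \<and>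
          cyc n X u = prim_sum n X a \<and> prim_sum_direct n X a \<and>
          prim_sum n X a \<subseteq> cyc n X v \<and> witness n X a v"
    by (intro allI impI, drule true) (elim conjE, intro conjI)
  ultimately show ?thesis
    unfolding res_def[symmetric] using false_iff by (intro conjI)
qed

end
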